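(* Let $\kappa>3$ be an integer, $S=\{1,\dots,\kappa\}$ with $r(x,y)\neq0$ if and only if $|x-y|=1$, and $S_\star=\{1,\kappa\}$. Assume that $d_N$ decays subexponentially (i.e. $\lim_{N\to\infty}d_Ne^{\delta N}=\infty$ for all $\delta>0$) and that $d_N\log N\to0$ as $N\to\infty$. Then there exist constants $0<C_1,C_2<\infty$ (not depending on $N$) such that, for $x,y\in S_\star$ with $x\neq y$, the average time to move the condensate from $x$ to $y$ satisfies $$C_1\le\liminf_{N\to\infty}\frac{d_N^3}{N^2}\,\mathbb{E}_{\mathcal{E}_N^x}(\tau_{\mathcal{E}_N^y})\le\limsup_{N\to\infty}\frac{d_N^3}{N^2}\,\mathbb{E}_{\mathcal{E}_N^x}(\tau_{\mathcal{E}_N^y})\le C_2.$$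
   Context: Random walk. $S$ is a finite set, $r:S\times S\to[0,\infty)$ are the jump rates of a continuous-time irreducible random walk on $S$, with $r(x,x)=0$, reversible with respect to a probability measure $m$ on $S$: $m(x)r(x,y)=m(y)r(y,x)$ for all $x,y\in S$. Let $M_\star=\max_{x\in S}m(x)$ and $S_\star=\{x\in S: m(x)=M_\star\}$. Inclusion process. $(d_N)_{N\ge1}$ is a sequence of positive numbers. For $N\ge1$ let $E_N=\{\eta\in\mathbb{N}^S:\sum_{x\in S}\eta_x=N\}$ (with $0\in\mathbb N$). For $\eta\in E_N$ with $\eta_x>0$ and $x\neq y$, $\eta^{x,y}$ is the configuration obtained from $\eta$ by moving one particle from $x$ to $y$. The reversible inclusion process $\{\eta(t):t\ge0\}$ is the continuous-time Markov process on $E_N$ with generator $$(L_NF)(\eta)=\sum_{x,y\in S}\eta_x(d_N+\eta_y)\,r(x,y)\,[F(\eta^{x,y})-F(\eta)],\qquad F:E_N\to\mathbb{R}.$$ For $x\in S_\star$, $\mathcal{E}_N^x=\{\eta\in E_N:\eta_x=N\}$ (a singleton). For $A\subseteq E_N$, $\tau_A=\inf\{t\ge0:\eta(t)\in A\}$. $\mathbb{E}_{\mathcal{E}_N^x}$ denotes expectation for the process started at the unique configuration in $\mathcal{E}_N^x$. *)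

theory Defs
  imports "HOL-Probability.Probability"
begin

section \<open>Finite-state continuous-time Markov processes\<close>

definition transition_semigroup :: "'s set \<Rightarrow> (real \<Rightarrow> 's \<Rightarrow> 's \<Rightarrow> real) \<Rightarrow> bool" where
  "transition_semigroup E p \<longleftrightarrow>
     (\<forall>t\<ge>0. \<forall>x\<in>E. \<forall>y\<in>E. 0 \<le> p t x y) \<and>
     (\<forall>t\<ge>0. \<forall>x\<in>E. (\<Sum>y\<in>E. p t x y) = 1) \<and>
     (\<forall>x\<in>E. \<forall>y\<in>E. p 0 x y = (if x = y then 1 else 0)) \<and>
     (\<forall>s\<ge>0. \<forall>t\<ge>0. \<forall>x\<in>E. \<forall>y\<in>E. p (s + t) x y = (\<Sum>z\<in>E. p s x z * p t z y))"

text \<open>Functions on \<open>E\<close> are represented by total functions. The condition below quantifies over all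
  of them, and is satisfiable only if \<open>L F\<close> restricted to \<open>E\<close> depends only on \<open>F\<close> restricted to \<open>E\<close>.\<close>

definition has_generator ::
  "'s set \<Rightarrow> (real \<Rightarrow> 's \<Rightarrow> 's \<Rightarrow> real) \<Rightarrow> (('s \<Rightarrow> real) \<Rightarrow> 's \<Rightarrow> real) \<Rightarrow> bool" where
  "has_generator E p L \<longleftrightarrow>
     (\<forall>F. \<forall>x\<in>E. ((\<lambda>t. ((\<Sum>y\<in>E. p t x y * F y) - F x) / t) \<longlongrightarrow> L F x) (at_right 0))"

text \<open>The process \<open>X\<close> on the probability space \<open>M\<close>, with time set \<open>[0, \<infinity>)\<close> and values in the finite
  set \<open>E\<close>, has right-continuous trajectories (for the discrete topology on \<open>E\<close>) and is Markov with a
  transition semigroup whose generator is \<open>L\<close>. The Markov property is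
  \<open>P(X(s+t) = y | X(u) = e u (u \<in> J), X(s) = x) = p t x y\<close> for finite \<open>J \<subseteq> [0, s]\<close>,
  multiplied by the probability of the conditioning event. The initial law is left free.\<close>

definition markov_process ::
  "'s set \<Rightarrow> (('s \<Rightarrow> real) \<Rightarrow> 's \<Rightarrow> real) \<Rightarrow> 'w measure \<Rightarrow> (real \<Rightarrow> 'w \<Rightarrow> 's) \<Rightarrow> bool" where
  "markov_process E L M X \<longleftrightarrow>
     finite E \<and> prob_space M \<and>
     (\<forall>t\<ge>0. X t \<in> measurable M (count_space E)) \<and>
     (\<forall>w\<in>space M. \<forall>t\<ge>0. eventually (\<lambda>s. X s w = X t w) (at_right t)) \<and>
     (\<exists>p. transition_semigroup E p \<and> has_generator E p L \<and>
       (\<forall>s\<ge>0. \<forall>t\<ge>0. \<forall>J e. \<forall>x\<in>E. \<forall>y\<in>E. finite J \<and> J \<subseteq> {0..s} \<longrightarrow>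
          measure M {w \<in> space M. (\<forall>u\<in>J. X u w = e u) \<and> X s w = x \<and> X (s + t) w = y} =
          measure M {w \<in> space M. (\<forall>u\<in>J. X u w = e u) \<and> X s w = x} * p t x y))"

text \<open>The value is \<open>\<infinity>\<close> if the trajectory never visits \<open>A\<close>.\<close>

definition hitting_time :: "(real \<Rightarrow> 'w \<Rightarrow> 's) \<Rightarrow> 's set \<Rightarrow> 'w \<Rightarrow> ennreal" where
  "hitting_time X A w = (INF t\<in>{t. 0 \<le> t \<and> X t w \<in> A}. ennreal t)"


section \<open>The underlying random walk\<close>

locale reversible_walk =
  fixes S :: "'a set" and r :: "'a \<Rightarrow> 'a \<Rightarrow> real" and m :: "'a \<Rightarrow> real"
  assumes finite_S: "finite S"
    and rate_nonneg: "x \<in> S \<Longrightarrow> y \<in> S \<Longrightarrow> 0 \<le> r x y"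
    and rate_diag: "x \<in> S \<Longrightarrow> r x x = 0"
    and irreducible_walk:
      "x \<in> S \<Longrightarrow> y \<in> S \<Longrightarrow> (x, y) \<in> {(a, b). a \<in> S \<and> b \<in> S \<and> 0 < r a b}\<^sup>*"
    and m_nonneg: "x \<in> S \<Longrightarrow> 0 \<le> m x"
    and m_sum: "(\<Sum>x\<in>S. m x) = 1"
    and detailed_balance: "x \<in> S \<Longrightarrow> y \<in> S \<Longrightarrow> m x * r x y = m y * r y x"

definition max_sites :: "'a set \<Rightarrow> ('a \<Rightarrow> real) \<Rightarrow> 'a set" where
  "max_sites S m = {x \<in> S. m x = Max (m ` S)}"


section \<open>The inclusion process\<close>

text \<open>Configurations on \<open>S\<close> are extended by zero outside \<open>S\<close>.\<close>

definition configs :: "'a set \<Rightarrow> nat \<Rightarrow> ('a \<Rightarrow> nat) set" where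
  "configs S N = {\<eta>. (\<forall>x. x \<notin> S \<longrightarrow> \<eta> x = 0) \<and> (\<Sum>x\<in>S. \<eta> x) = N}"

text \<open>Meaningful only for \<open>x \<noteq> y\<close> and \<open>\<eta> x > 0\<close>; in the generator all other terms carry a factor
  \<open>r x x = 0\<close> or \<open>\<eta> x = 0\<close>.\<close>

definition move :: "('a \<Rightarrow> nat) \<Rightarrow> 'a \<Rightarrow> 'a \<Rightarrow> 'a \<Rightarrow> nat" where
  "move \<eta> x y = \<eta>(x := \<eta> x - 1, y := \<eta> y + 1)"

definition inclusion_generator ::
  "'a set \<Rightarrow> ('a \<Rightarrow> 'a \<Rightarrow> real) \<Rightarrow> real \<Rightarrow> (('a \<Rightarrow> nat) \<Rightarrow> real) \<Rightarrow> ('a \<Rightarrow> nat) \<Rightarrow> real" where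
  "inclusion_generator S r d F \<eta> =
     (\<Sum>x\<in>S. \<Sum>y\<in>S. real (\<eta> x) * (d + real (\<eta> y)) * r x y * (F (move \<eta> x y) - F \<eta>))"

text \<open>For \<open>x \<in> S\<close> this is a singleton.\<close>

definition condensate :: "'a set \<Rightarrow> nat \<Rightarrow> 'a \<Rightarrow> ('a \<Rightarrow> nat) set" where
  "condensate S N x = {\<eta> \<in> configs S N. \<eta> x = N}"

definition inclusion_process_from ::
  "'a set \<Rightarrow> ('a \<Rightarrow> 'a \<Rightarrow> real) \<Rightarrow> real \<Rightarrow> nat \<Rightarrow> 'a \<Rightarrow> 'w measure \<Rightarrow> (real \<Rightarrow> 'w \<Rightarrow> 'a \<Rightarrow> nat) \<Rightarrow> bool" where
  "inclusion_process_from S r d N x M \<eta> \<longleftrightarrow>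
     markov_process (configs S N) (inclusion_generator S r d) M \<eta> \<and>
     (AE w in M. \<eta> 0 w \<in> condensate S N x)"

end

theory Submission imports Defs
begin

text \<open>The inclusion process is reversible with respect to the product weight
\<open>\<Prod>x\<in>S. \<alpha> x ^ \<eta> x * inclusion_weight d (\<eta> x)\<close>, where \<open>\<alpha> = m / max m\<close>, so it is a random walk on an
electrical network of configurations. The expected time \<open>h\<close> to reach the pile at \<open>b\<close> from the pile
at \<open>a\<close> satisfies
\<open>weight a / energy F \<le> h a \<le> total weight * R\<close>
for every test function \<open>F\<close> with \<open>F a = 1\<close>, \<open>F b = 0\<close> and every upper bound \<open>R\<close> on the effective
resistance between \<open>a\<close> and \<open>b\<close> (\<open>hitting_potential_bounds\<close>). Bounds
up to constants for the energy and the resistance are therefore enough.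

When \<open>d * ln N\<close> is small, a pile of \<open>k\<close> particles has weight of order \<open>d / k\<close>
(\<open>inclusion_weight_ge\<close>, \<open>inclusion_weight_le\<close>), and so the total weight and the weight of a full pile are
both of order \<open>d / N\<close>.

For the resistance, move the particles from one end to the other one at a time. While a single
particle crosses the empty interior, the two piles at the ends have joint weight at least
\<open>(d / N)\<^sup>2\<close> and the step between two empty sites contributes another \<open>d\<^sup>2\<close>. The route consists of \<open>O(N)\<close>
edges of conductance at least of order \<open>d ^ 4 / N\<^sup>2\<close>, so the resistance is at most of order
\<open>N ^ 3 / d ^ 4\<close> (\<open>path_poincare\<close>).

For the energy, let \<open>F\<close> be a piecewise linear function of the number of particles at the sites \<open>1\<close> and
\<open>2\<close>, constant unless both sides hold a positive fraction of the particles. Only jumps between \<open>2\<close> and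
\<open>3\<close> change \<open>F\<close>. For \<open>\<kappa> > 3\<close> both of these sites are interior, where \<open>\<alpha> < 1\<close> makes occupation
exponentially unlikely, and each side of the cut then has weight of order \<open>d\<^sup>2 / N\<close>. The subexponential
decay of \<open>d\<close> is what makes the exponentially small contribution of the configurations with a pile at
\<open>2\<close> or \<open>3\<close> negligible against this. The energy is of order \<open>d ^ 4 / N ^ 3\<close> (\<open>ramp_energy_le\<close>), and the
two bounds on \<open>h a\<close> agree up to constants: \<open>h a\<close> is of order \<open>N\<^sup>2 / d ^ 3\<close>.

It remains to identify the solution \<open>h\<close> of the Poisson equation with the expectation of the hitting time
of a process that is known only through its finite-dimensional distributions and the right continuity
of its paths. This is done by sampling the process on finer and finer time grids
(\<open>nn_integral_hitting_time\<close>).\<close>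

section \<open>Dirichlet forms of finite networks\<close>

text \<open>Gaussian elimination: positive definiteness makes every diagonal entry a legitimate pivot and is
inherited by the Schur complement.\<close>

lemma positive_definite_system_solvable:
  fixes A :: "'s \<Rightarrow> 's \<Rightarrow> real" and b :: "'s \<Rightarrow> real"
  assumes "finite D"
    and "\<And>f. \<exists>x\<in>D. f x \<noteq> 0 \<Longrightarrow> 0 < (\<Sum>x\<in>D. f x * (\<Sum>y\<in>D. A x y * f y))"
  shows "\<exists>f. \<forall>x\<in>D. (\<Sum>y\<in>D. A x y * f y) = b x"
  using assms
proof (induction D arbitrary: A b rule: finite_induct)
  case empty
  then show ?case by simp
next
  case (insert z D)
  have pivot: "A z z > 0"
  proof -
    have "0 < (\<Sum>x\<in>insert z D. (if x = z then 1 else 0) *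
                (\<Sum>y\<in>insert z D. A x y * (if y = z then 1 else 0)))"
      by (rule insert.prems) auto
    then show ?thesis using insert.hyps(1,2)
      by (simp add: mult_delta_left mult_delta_right del: sum.insert)
  qed
  define A' where "A' x y = A x y - A x z * A z y / A z z" for x y
  have elim: "(\<Sum>y\<in>D. A x y * f y) + A x z * ((s - (\<Sum>y\<in>D. A z y * f y)) / A z z)
      = (\<Sum>y\<in>D. A' x y * f y) + A x z * s / A z z" for f x s
  proof -
    have "(\<Sum>y\<in>D. A' x y * f y) = (\<Sum>y\<in>D. A x y * f y) - (A x z / A z z) * (\<Sum>y\<in>D. A z y * f y)"
      by (simp add: A'_def algebra_simps sum_subtractf sum_distrib_left sum_divide_distrib)
    then show ?thesis using pivot by (simp add: field_simps)
  qed
  have "0 < (\<Sum>x\<in>D. f x * (\<Sum>y\<in>D. A' x y * f y))" if f: "\<exists>x\<in>D. f x \<noteq> 0" for f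
  proof -
    \<comment> \<open>Extend \<open>f\<close> to \<open>z\<close> by the minimiser, which turns the form of \<open>A\<close> into that of the Schur complement.\<close>
    define s where "s = - (\<Sum>y\<in>D. A z y * f y) / A z z"
    let ?g = "f(z := s)"
    have eq: "(\<Sum>y\<in>D. A x y * ?g y) = (\<Sum>y\<in>D. A x y * f y)" for x
      using insert.hyps by (intro sum.cong) auto
    have "0 < (\<Sum>x\<in>insert z D. ?g x * (\<Sum>y\<in>insert z D. A x y * ?g y))"
      using f insert.hyps by (intro insert.prems) auto
    also have "\<dots> = s * (A z z * s + (\<Sum>y\<in>D. A z y * f y))
        + (\<Sum>x\<in>D. ?g x * (A x z * s + (\<Sum>y\<in>D. A x y * f y)))"
      using insert.hyps by (simp add: eq fun_upd_same del: fun_upd_apply)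
    also have "A z z * s + (\<Sum>y\<in>D. A z y * f y) = 0"
      using pivot by (simp add: s_def)
    also have "(\<Sum>x\<in>D. ?g x * (A x z * s + (\<Sum>y\<in>D. A x y * f y)))
        = (\<Sum>x\<in>D. f x * (\<Sum>y\<in>D. A' x y * f y))"
    proof (intro sum.cong refl)
      fix x assume "x \<in> D"
      then have "x \<noteq> z" using insert.hyps by auto
      then show "?g x * (A x z * s + (\<Sum>y\<in>D. A x y * f y)) = f x * (\<Sum>y\<in>D. A' x y * f y)"
        using elim[of x f 0] by (simp add: s_def algebra_simps)
    qed
    finally show ?thesis by simp
  qed
  from insert.IH[OF this, of "\<lambda>x. b x - A x z * b z / A z z"]
  obtain f where f: "\<forall>x\<in>D. (\<Sum>y\<in>D. A' x y * f y) = b x - A x z * b z / A z z"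
    by blast
  define s where "s = (b z - (\<Sum>y\<in>D. A z y * f y)) / A z z"
  have eq: "(\<Sum>y\<in>D. A x y * (f(z := s)) y) = (\<Sum>y\<in>D. A x y * f y)" for x
    using insert.hyps by (intro sum.cong) auto
  have "(\<Sum>y\<in>insert z D. A x y * (f(z := s)) y) = b x" if x: "x \<in> insert z D" for x
  proof (cases "x = z")
    case True
    then show ?thesis using insert.hyps pivot by (simp add: eq fun_upd_same del: fun_upd_apply) (simp add: s_def)
  next
    case False
    then have "(\<Sum>y\<in>D. A x y * f y) + A x z * s = b x"
      using elim[of x f "b z"] x f by (simp add: s_def)
    then show ?thesis using insert.hyps by (simp add: eq fun_upd_same del: fun_upd_apply)
  qed
  then show ?case by blast
qed

text \<open>A finite weighted graph, with parallel edges and loops allowed, seen through its Dirichlet form. The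
last assumption is connectedness, stated in the way it is used.\<close>

locale finite_network =
  fixes E :: "'s set" and I :: "'i set" and src tgt :: "'i \<Rightarrow> 's" and c :: "'i \<Rightarrow> real"
  assumes finite_E: "finite E" and finite_I: "finite I"
    and src_in: "i \<in> I \<Longrightarrow> src i \<in> E" and tgt_in: "i \<in> I \<Longrightarrow> tgt i \<in> E"
    and c_nonneg: "i \<in> I \<Longrightarrow> 0 \<le> c i"
    and zero_energy_constant:
      "(\<Sum>i\<in>I. c i * (F (src i) - F (tgt i))\<^sup>2) = 0 \<Longrightarrow> x \<in> E \<Longrightarrow> y \<in> E \<Longrightarrow> F x = F y"
begin

definition form :: "('s \<Rightarrow> real) \<Rightarrow> ('s \<Rightarrow> real) \<Rightarrow> real" where
  "form F G = (\<Sum>i\<in>I. c i * ((F (src i) - F (tgt i)) * (G (src i) - G (tgt i))))"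

lemma form_self: "form F F = (\<Sum>i\<in>I. c i * (F (src i) - F (tgt i))\<^sup>2)"
  by (simp add: form_def power2_eq_square)

lemma form_nonneg: "0 \<le> form F F"
  unfolding form_self by (intro sum_nonneg mult_nonneg_nonneg c_nonneg) auto

lemma form_commute: "form F G = form G F"
  by (simp add: form_def mult.commute)

lemma form_cong: "(\<And>x. x \<in> E \<Longrightarrow> F x = F' x) \<Longrightarrow> (\<And>x. x \<in> E \<Longrightarrow> G x = G' x) \<Longrightarrow> form F G = form F' G'"
  unfolding form_def by (intro sum.cong refl) (simp add: src_in tgt_in)

lemma form_shift: "form F (\<lambda>x. G x - k) = form F G"
  by (simp add: form_def)

lemma form_sum_left:
  "form (\<lambda>v. \<Sum>y\<in>D. f y * k y v) G = (\<Sum>y\<in>D. f y * form (k y) G)"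
proof -
  have "form (\<lambda>v. \<Sum>y\<in>D. f y * k y v) G
      = (\<Sum>i\<in>I. \<Sum>y\<in>D. f y * (c i * ((k y (src i) - k y (tgt i)) * (G (src i) - G (tgt i)))))"
    unfolding form_def
    by (intro sum.cong refl)
       (simp add: sum_subtractf[symmetric] sum_distrib_left sum_distrib_right algebra_simps)
  also have "\<dots> = (\<Sum>y\<in>D. f y * form (k y) G)"
    unfolding form_def sum_distrib_left by (rule sum.swap)
  finally show ?thesis .
qed

lemma form_Cauchy_Schwarz: "(form F G)\<^sup>2 \<le> form F F * form G G"
proof -
  let ?f = "\<lambda>i. sqrt (c i) * (F (src i) - F (tgt i))"
  let ?g = "\<lambda>i. sqrt (c i) * (G (src i) - G (tgt i))"
  have "form F G = (\<Sum>i\<in>I. ?f i * ?g i)"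
    unfolding form_def by (intro sum.cong refl) (simp add: c_nonneg mult.assoc mult.left_commute flip: real_sqrt_mult)
  moreover have "form F F = (\<Sum>i\<in>I. (?f i)\<^sup>2)" "form G G = (\<Sum>i\<in>I. (?g i)\<^sup>2)"
    unfolding form_self by (intro sum.cong refl; simp add: c_nonneg power_mult_distrib)+
  ultimately show ?thesis using Cauchy_Schwarz_ineq_sum[of ?f ?g I] by simp
qed

lemma form_zero_imp_zero:
  assumes "form F F = 0" "b \<in> E" "F b = 0" "x \<in> E"
  shows "F x = 0"
  using zero_energy_constant[of F x b] assms by (simp add: form_self)

text \<open>The Poisson equation with source \<open>f\<close> and a grounded vertex \<open>b\<close>, in weak form. Connectedness makes the
Dirichlet form positive definite on functions that vanish at \<open>b\<close>, hence the linear system for the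
values on the other vertices is solvable.\<close>

lemma weak_solution_exists:
  assumes b: "b \<in> E"
  shows "\<exists>u. u b = 0 \<and> (\<forall>G. G b = 0 \<longrightarrow> form u G = (\<Sum>x\<in>E. f x * G x))"
proof -
  define D where "D = E - {b}"
  have fin: "finite D" and bD: "b \<notin> D" using finite_E by (auto simp: D_def)
  let ?e = "\<lambda>y v. if v = y then 1 else (0::real)"
  let ?ext = "\<lambda>g v. if v \<in> D then g v else (0::real)"
  have ext: "form (?ext g) G = (\<Sum>y\<in>D. g y * form (?e y) G)" for g G
  proof -
    have "form (?ext g) G = form (\<lambda>v. \<Sum>y\<in>D. g y * ?e y v) G"
      using fin by (intro form_cong) (auto simp: if_distrib cong: if_cong)
    then show ?thesis by (simp only: form_sum_left)
  qed
  have "\<exists>g. \<forall>x\<in>D. (\<Sum>y\<in>D. form (?e y) (?e x) * g y) = f x"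
  proof (rule positive_definite_system_solvable[OF fin])
    fix g :: "'s \<Rightarrow> real" assume g: "\<exists>x\<in>D. g x \<noteq> 0"
    have "(\<Sum>x\<in>D. g x * (\<Sum>y\<in>D. form (?e y) (?e x) * g y)) = (\<Sum>x\<in>D. g x * form (?e x) (?ext g))"
      using ext[of g] by (intro sum.cong refl) (simp add: form_commute[of _ "?ext g"] mult.commute)
    also have "\<dots> = form (?ext g) (?ext g)"
      by (simp only: ext)
    finally have *: "(\<Sum>x\<in>D. g x * (\<Sum>y\<in>D. form (?e y) (?e x) * g y)) = form (?ext g) (?ext g)" .
    have "form (?ext g) (?ext g) \<noteq> 0"
    proof
      assume "form (?ext g) (?ext g) = 0"
      then have "?ext g x = 0" if "x \<in> E" for x
        using form_zero_imp_zero[of "?ext g" b x] b bD that by simp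
      then have "g x = 0" if "x \<in> D" for x
        using that by (metis D_def DiffD1)
      then show False using g by blast
    qed
    then show "0 < (\<Sum>x\<in>D. g x * (\<Sum>y\<in>D. form (?e y) (?e x) * g y))"
      using form_nonneg[of "?ext g"] unfolding * by linarith
  qed
  then obtain g where g: "\<And>x. x \<in> D \<Longrightarrow> (\<Sum>y\<in>D. form (?e y) (?e x) * g y) = f x" by blast
  have "form (?ext g) G = (\<Sum>x\<in>E. f x * G x)" if G: "G b = 0" for G
  proof -
    have "form (?ext g) G = form (?ext G) (?ext g)"
      using G by (subst form_commute, intro form_cong) (auto simp: D_def)
    also have "\<dots> = (\<Sum>x\<in>D. G x * form (?ext g) (?e x))"
      using ext[of G "?ext g"] by (simp add: form_commute[of _ "?ext g"])
    also have "\<dots> = (\<Sum>x\<in>D. f x * G x)"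
    proof (intro sum.cong refl)
      fix x assume "x \<in> D"
      then show "G x * form (?ext g) (?e x) = f x * G x"
        using g[of x] by (simp only: ext mult.commute)
    qed
    also have "\<dots> = (\<Sum>x\<in>E. f x * G x)"
      using G finite_E by (intro sum.mono_neutral_left) (auto simp: D_def)
    finally show ?thesis .
  qed
  then show ?thesis using bD by (intro exI[of _ "?ext g"]) simp
qed

text \<open>Cutting off a function from below decreases each edge difference without changing its sign. Testing
an equation with a truncation of its own solution then gives the maximum principle.\<close>

lemma truncation_energy:
  "form (\<lambda>x. max 0 (u x - k)) (\<lambda>x. max 0 (u x - k)) \<le> form u (\<lambda>x. max 0 (u x - k))"
  unfolding form_def
proof (intro sum_mono mult_left_mono c_nonneg)
  fix i
  show "(max 0 (u (src i) - k) - max 0 (u (tgt i) - k)) * (max 0 (u (src i) - k) - max 0 (u (tgt i) - k))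
      \<le> (u (src i) - u (tgt i)) * (max 0 (u (src i) - k) - max 0 (u (tgt i) - k))"
  proof -
    have *: "(max 0 s - max 0 t) * (max 0 s - max 0 t) \<le> (s - t) * (max 0 s - max 0 t)" for s t :: real
      by (auto simp: max_def algebra_simps mult_nonpos_nonneg mult_nonneg_nonpos mult_nonneg_nonpos2)
    show ?thesis using *[of "u (src i) - k" "u (tgt i) - k"] by simp
  qed
qed

lemma weak_supersolution_nonneg:
  assumes W: "\<And>x. x \<in> E \<Longrightarrow> 0 \<le> W x" and b: "b \<in> E" "h b = 0"
    and h: "\<And>G. G b = 0 \<Longrightarrow> form h G = (\<Sum>x\<in>E. W x * G x)"
    and x: "x \<in> E"
  shows "0 \<le> h x"
proof -
  let ?G = "\<lambda>x. max 0 ((- h x) - 0)"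
  have neg: "form (\<lambda>x. - h x) G = - form h G" for G
    by (simp add: form_def sum_negf[symmetric] algebra_simps)
  have "form ?G ?G \<le> form (\<lambda>x. - h x) ?G" by (rule truncation_energy)
  also have "\<dots> = - (\<Sum>x\<in>E. W x * ?G x)" unfolding neg using b by (subst h) auto
  also have "\<dots> \<le> 0" using W by (auto intro!: sum_nonneg)
  finally have "form ?G ?G = 0" using form_nonneg[of ?G] by linarith
  then have "?G x = 0" using form_zero_imp_zero[of ?G b x] b x by simp
  then show ?thesis by (simp add: max_def split: if_splits)
qed

text \<open>The function \<open>h\<close> plays the role of the expected time to reach \<open>b\<close>. Its value at \<open>a\<close> is compared with
the potential \<open>u\<close> of a unit current from \<open>a\<close> to \<open>b\<close>: testing the two equations with each other gives
\<open>h a = (\<Sum>x\<in>E. W x * u x)\<close>, and \<open>0 \<le> u \<le> u a\<close> by the maximum principle. The number \<open>u a\<close> is the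
effective resistance between \<open>a\<close> and \<open>b\<close>. It is at most \<open>R\<close> by the first hypothesis, applied to \<open>u\<close>
itself, and at least \<open>1 / form F F\<close> by the Cauchy-Schwarz inequality.\<close>

lemma hitting_potential_bounds:
  assumes W: "\<And>x. x \<in> E \<Longrightarrow> 0 \<le> W x" and a: "a \<in> E" and b: "b \<in> E" "h b = 0"
    and h: "\<And>G. G b = 0 \<Longrightarrow> form h G = (\<Sum>x\<in>E. W x * G x)"
  shows hitting_potential_le:
      "0 \<le> R \<Longrightarrow> (\<And>F. (F a - F b)\<^sup>2 \<le> R * form F F) \<Longrightarrow> h a \<le> (\<Sum>x\<in>E. W x) * R"
    and hitting_potential_ge: "\<bar>F a - F b\<bar> = 1 \<Longrightarrow> W a \<le> h a * form F F"
proof -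
  obtain u where ub: "u b = 0"
    and u': "\<And>G. G b = 0 \<Longrightarrow> form u G = (\<Sum>x\<in>E. (if x = a then 1 else 0) * G x)"
    using weak_solution_exists[OF b(1), of "\<lambda>x. if x = a then 1 else 0"] by blast
  have u: "form u G = G a" if "G b = 0" for G
    using u'[of G] that a finite_E by (simp add: mult_delta_left)
  have uu: "form u u = u a" using u[of u] ub by simp
  have u_nonneg: "0 \<le> u x" if "x \<in> E" for x
    using weak_supersolution_nonneg[of "\<lambda>x. if x = a then 1 else 0" b u x] b ub u' that by auto
  have ha: "h a = (\<Sum>x\<in>E. W x * u x)"
    using u[of h] h[of u] ub b by (simp add: form_commute)
  show "h a \<le> (\<Sum>x\<in>E. W x) * R" if R0: "0 \<le> R" and R: "\<And>F. (F a - F b)\<^sup>2 \<le> R * form F F"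
  proof -
    have "u x \<le> u a" if x: "x \<in> E" for x
    proof -
      let ?G = "\<lambda>x. max 0 (u x - u a)"
      have "form ?G ?G \<le> form u ?G" by (rule truncation_energy)
      also have "\<dots> = 0" using ub u_nonneg[OF a] by (subst u) auto
      finally have "form ?G ?G = 0" using form_nonneg[of ?G] by linarith
      then have "?G x = 0" using form_zero_imp_zero[of ?G b x] b x ub u_nonneg[OF a] by simp
      then show ?thesis by (simp add: max_def split: if_splits)
    qed
    then have "h a \<le> (\<Sum>x\<in>E. W x * u a)"
      unfolding ha by (intro sum_mono mult_left_mono W)
    then have 1: "h a \<le> (\<Sum>x\<in>E. W x) * u a" by (simp add: sum_distrib_right)
    have "(u a)\<^sup>2 \<le> R * u a" using R[of u] by (simp add: ub uu)
    then have "u a \<le> R" using u_nonneg[OF a] R0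
      by (cases "u a = 0") (auto simp: power2_eq_square)
    then show ?thesis using 1 W
      by (meson mult_left_mono order_trans sum_nonneg)
  qed
  show "W a \<le> h a * form F F" if F: "\<bar>F a - F b\<bar> = 1"
  proof -
    have "form u F = F a - F b"
      using u[of "\<lambda>x. F x - F b"] by (simp add: form_shift)
    moreover have "(F a - F b)\<^sup>2 = 1"
      using F power2_abs[of "F a - F b"] by simp
    ultimately have "1 \<le> u a * form F F"
      using form_Cauchy_Schwarz[of u F] by (simp add: uu)
    then have "W a \<le> W a * (u a * form F F)"
      using W[OF a] mult_left_mono by fastforce
    also have "W a * u a \<le> h a"
      unfolding ha using a finite_E W u_nonneg
      by (intro member_le_sum) auto
    then have "W a * (u a * form F F) \<le> h a * form F F"
      using form_nonneg[of F] by (metis mult.assoc mult_right_mono)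
    finally show ?thesis .
  qed
qed

end

section \<open>Expected hitting times of finite-state Markov processes\<close>

definition grid_hitting_time :: "(real \<Rightarrow> 'w \<Rightarrow> 's) \<Rightarrow> 's set \<Rightarrow> real \<Rightarrow> 'w \<Rightarrow> ennreal" where
  "grid_hitting_time X A \<epsilon> w = (INF k\<in>{k. X (real k * \<epsilon>) w \<in> A}. ennreal (real k * \<epsilon>))"

lemma hitting_time_le_grid:
  assumes "0 \<le> \<epsilon>"
  shows "hitting_time X A w \<le> grid_hitting_time X A \<epsilon> w"
  unfolding grid_hitting_time_def hitting_time_def
  by (rule INF_greatest) (use assms in \<open>auto intro!: INF_lower\<close>)

lemma grid_hitting_time_halve:
  "grid_hitting_time X A (\<epsilon> / 2) w \<le> grid_hitting_time X A \<epsilon> w"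
  unfolding grid_hitting_time_def
proof (rule INF_greatest)
  fix k assume "k \<in> {k. X (real k * \<epsilon>) w \<in> A}"
  then show "(INF k\<in>{k. X (real k * (\<epsilon> / 2)) w \<in> A}. ennreal (real k * (\<epsilon> / 2))) \<le> ennreal (real k * \<epsilon>)"
    by (intro INF_lower2[of "2 * k"]) auto
qed

text \<open>By right continuity the process stays in \<open>A\<close> for some time after each visit, so a sufficiently fine
grid detects the visit with a delay of at most one step.\<close>

lemma hitting_time_eq_INF_grid:
  assumes rc: "\<And>t. 0 \<le> t \<Longrightarrow> eventually (\<lambda>s. X s w = X t w) (at_right t)"
    and e0: "0 < e0"
  shows "hitting_time X A w = (INF n. grid_hitting_time X A (e0 / 2 ^ n) w)"
proof (rule antisym)
  show "hitting_time X A w \<le> (INF n. grid_hitting_time X A (e0 / 2 ^ n) w)"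
    by (rule INF_greatest, rule hitting_time_le_grid) (use e0 in auto)
  show "(INF n. grid_hitting_time X A (e0 / 2 ^ n) w) \<le> hitting_time X A w"
    unfolding hitting_time_def
  proof (rule INF_greatest)
    fix t assume "t \<in> {t. 0 \<le> t \<and> X t w \<in> A}"
    then have t: "0 \<le> t" "X t w \<in> A" by auto
    from rc[OF t(1)] obtain u where u: "t < u" "\<And>s. t < s \<Longrightarrow> s < u \<Longrightarrow> X s w = X t w"
      by (auto simp: eventually_at_right_field)
    show "(INF n. grid_hitting_time X A (e0 / 2 ^ n) w) \<le> ennreal t"
    proof (rule ennreal_le_epsilon)
      fix e :: real assume e: "0 < e"
      define \<delta> where "\<delta> = min e (u - t)"
      have \<delta>: "0 < \<delta>" using e u(1) by (simp add: \<delta>_def)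
      obtain n where n: "e0 / 2 ^ n < \<delta>"
      proof -
        obtain n where "(1/2) ^ n < \<delta> / e0"
          using real_arch_pow_inv[of "\<delta> / e0" "1/2"] \<delta> e0 by auto
        then show ?thesis using that[of n] e0 by (simp add: field_simps power_one_over)
      qed
      define g where "g = e0 / 2 ^ n"
      have g: "0 < g" "g < \<delta>" using e0 n by (auto simp: g_def)
      define k where "k = nat \<lceil>t / g\<rceil>"
      have "0 \<le> t / g" using t g by simp
      then have k': "real k = of_int \<lceil>t / g\<rceil>" by (simp add: k_def)
      have "t / g \<le> real k" "real k < t / g + 1" unfolding k' by linarith+
      then have k: "t \<le> real k * g" "real k * g < t + g"
        using g by (simp_all add: field_simps)
      have "X (real k * g) w \<in> A"
      proof (cases "real k * g = t")
        case False
        then have "X (real k * g) w = X t w" using k g by (intro u(2)) (auto simp: \<delta>_def)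
        then show ?thesis using t by simp
      qed (use t in simp)
      then have "grid_hitting_time X A g w \<le> ennreal (real k * g)"
        unfolding grid_hitting_time_def by (intro INF_lower) auto
      also have "\<dots> \<le> ennreal t + ennreal e"
        using k g t e by (subst ennreal_plus[symmetric]) (auto simp: \<delta>_def simp del: ennreal_plus intro!: ennreal_leI)
      finally show "(INF n. grid_hitting_time X A (e0 / 2 ^ n) w) \<le> ennreal t + ennreal e"
        unfolding g_def by (rule INF_lower2[OF UNIV_I])
    qed
  qed
qed

text \<open>The layer-cake formula on the grid: every step survived outside \<open>A\<close> contributes \<open>\<epsilon>\<close>.\<close>

lemma grid_hitting_time_eq_suminf:
  assumes "0 < \<epsilon>"
  shows "grid_hitting_time X A \<epsilon> w
    = (\<Sum>k. ennreal \<epsilon> * (if \<forall>i\<le>k. X (real i * \<epsilon>) w \<notin> A then 1 else 0))"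
proof (cases "\<exists>k. X (real k * \<epsilon>) w \<in> A")
  case False
  then have "(\<Sum>k. ennreal \<epsilon> * (if \<forall>i\<le>k. X (real i * \<epsilon>) w \<notin> A then 1 else 0)) = (\<Sum>k. ennreal \<epsilon> * 1)"
    by (intro suminf_cong) auto
  also have "\<dots> = (\<Sum>k. ennreal \<epsilon>)" by (simp only: mult_1_right)
  also have "\<dots> = \<infinity>"
  proof -
    have "(\<Sum>k. ennreal \<epsilon>) \<ge> ennreal x" for x
    proof -
      obtain n where "x \<le> real n * \<epsilon>" using assms
        by (metis mult.commute reals_Archimedean3 less_imp_le)
      then have "ennreal x \<le> ennreal (real n * \<epsilon>)" by (rule ennreal_leI)
      also have "\<dots> = (\<Sum>k<n. ennreal \<epsilon>)"
        using assms by (simp add: ennreal_mult ennreal_of_nat_eq_real_of_nat)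
      also have "\<dots> \<le> (\<Sum>k. ennreal \<epsilon>)" by (rule sum_le_suminf) auto
      finally show ?thesis .
    qed
    note large = this
    show ?thesis
    proof (cases "\<Sum>k :: nat. ennreal \<epsilon>")
      case (real x)
      then have "ennreal (x + 1) \<le> ennreal x" using large[of "x + 1"] by simp
      then show ?thesis using real(1) by (simp add: ennreal_le_iff)
    qed simp
  qed
  finally have "(\<Sum>k. ennreal \<epsilon> * (if \<forall>i\<le>k. X (real i * \<epsilon>) w \<notin> A then 1 else 0)) = \<infinity>" .
  then show ?thesis using False by (simp only: grid_hitting_time_def) simp
next
  case True
  define K where "K = (LEAST k. X (real k * \<epsilon>) w \<in> A)"
  have K: "X (real K * \<epsilon>) w \<in> A" unfolding K_def using True by (rule LeastI_ex)
  have K_min: "K \<le> k" if "X (real k * \<epsilon>) w \<in> A" for k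
    unfolding K_def using that by (rule Least_le)
  have alive: "(\<forall>i\<le>k. X (real i * \<epsilon>) w \<notin> A) \<longleftrightarrow> k < K" for k
    using K K_min by (meson le_trans not_le)
  have "(\<Sum>k. ennreal \<epsilon> * (if \<forall>i\<le>k. X (real i * \<epsilon>) w \<notin> A then 1 else 0))
      = (\<Sum>k\<in>{..<K}. ennreal \<epsilon> * (if \<forall>i\<le>k. X (real i * \<epsilon>) w \<notin> A then 1 else 0))"
    by (rule suminf_finite) (auto simp: alive)
  also have "\<dots> = ennreal (real K * \<epsilon>)"
    using assms by (simp add: alive ennreal_mult ennreal_of_nat_eq_real_of_nat)
  also have "\<dots> = grid_hitting_time X A \<epsilon> w"
    unfolding grid_hitting_time_def
  proof (rule antisym)
    show "ennreal (real K * \<epsilon>) \<le> (INF k\<in>{k. X (real k * \<epsilon>) w \<in> A}. ennreal (real k * \<epsilon>))"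
      using assms by (intro INF_greatest ennreal_leI) (auto intro!: mult_right_mono K_min)
  qed (use K in \<open>auto intro!: INF_lower\<close>)
  finally show ?thesis by simp
qed

lemma confined_decomposition:
  "{w \<in> A. (\<forall>i<Suc k. F i w \<in> D) \<and> Q w} = (\<Union>x\<in>D. {w \<in> A. (\<forall>i<k. F i w \<in> D) \<and> F k w = x \<and> Q w})"
  by (auto simp: All_less_Suc)

lemma disjoint_fibres: "disjoint_family_on (\<lambda>x. {w \<in> A. P w \<and> F w = x \<and> Q w}) D"
  by (auto simp: disjoint_family_on_def)

lemma suminf_indicator:
  fixes c :: ennreal
  assumes [measurable]: "\<And>k :: nat. A k \<in> sets M"
  shows measurable_suminf_indicator: "(\<lambda>w. \<Sum>k. c * indicator (A k) w) \<in> borel_measurable M"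
    and nn_integral_suminf_indicator:
      "(\<integral>\<^sup>+ w. (\<Sum>k. c * indicator (A k) w) \<partial>M) = (\<Sum>k. c * emeasure M (A k))"
  by (measurable, subst nn_integral_suminf) (auto simp: nn_integral_cmult_indicator)

text \<open>Here the transition function \<open>p\<close> is a fixed parameter, whereas \<open>markov_process\<close> only asserts its
existence.\<close>

locale finite_markov = prob_space M for M :: "'w measure" +
  fixes E :: "'s set" and X :: "real \<Rightarrow> 'w \<Rightarrow> 's" and p :: "real \<Rightarrow> 's \<Rightarrow> 's \<Rightarrow> real"
  assumes finite_states: "finite E"
    and X_measurable: "0 \<le> t \<Longrightarrow> X t \<in> measurable M (count_space E)"
    and right_continuous:
      "w \<in> space M \<Longrightarrow> 0 \<le> t \<Longrightarrow> eventually (\<lambda>s. X s w = X t w) (at_right t)"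
    and markov: "0 \<le> s \<Longrightarrow> 0 \<le> t \<Longrightarrow> finite J \<Longrightarrow> J \<subseteq> {0..s} \<Longrightarrow> x \<in> E \<Longrightarrow> y \<in> E \<Longrightarrow>
       prob {w \<in> space M. (\<forall>u\<in>J. X u w = e u) \<and> X s w = x \<and> X (s + t) w = y} =
       prob {w \<in> space M. (\<forall>u\<in>J. X u w = e u) \<and> X s w = x} * p t x y"
begin

lemma X_in: "0 \<le> t \<Longrightarrow> w \<in> space M \<Longrightarrow> X t w \<in> E"
  using measurable_space[OF X_measurable] by simp

lemma pred_X: 
  assumes "0 \<le> t" shows "Measurable.pred M (\<lambda>w. P (X t w))"
proof -
  have "(\<lambda>w. P (X t w)) -` {True} \<inter> space M = X t -` {x \<in> E. P x} \<inter> space M"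
    using X_in[OF assms] by auto
  also have "\<dots> \<in> sets M"
    by (rule measurable_sets[OF X_measurable[OF assms]]) auto
  finally show ?thesis by (simp add: pred_def vimage_def Int_def conj_commute)
qed

lemma pred_all_X:
  assumes "finite J" "\<And>i. i \<in> J \<Longrightarrow> 0 \<le> g i"
  shows "Measurable.pred M (\<lambda>w. \<forall>i\<in>J. P i (X (g i) w))"
  using assms(1) by (rule pred_intros_finite) (rule pred_X[OF assms(2)])

text \<open>The Markov property conditions on exact past values. Summing over all of the finitely many pasts
inside \<open>D\<close> gives the version that conditions on not having left \<open>D\<close>.\<close>

lemma markov_confined:
  assumes "0 \<le> s" "0 \<le> t" "finite J" "J \<subseteq> {0..s}" "x \<in> E" "y \<in> E" and D: "D \<subseteq> E"
  shows "prob {w \<in> space M. (\<forall>u\<in>J. X u w \<in> D) \<and> X s w = x \<and> X (s + t) w = y} =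
       prob {w \<in> space M. (\<forall>u\<in>J. X u w \<in> D) \<and> X s w = x} * p t x y"
proof -
  have J: "u \<in> J \<Longrightarrow> 0 \<le> u" for u using assms by auto
  have fin: "finite (PiE J (\<lambda>_. D))"
    using assms finite_states finite_subset by (auto intro!: finite_PiE)
  have split: "prob {w \<in> space M. (\<forall>u\<in>J. X u w \<in> D) \<and> Q w}
      = (\<Sum>e\<in>PiE J (\<lambda>_. D). prob {w \<in> space M. (\<forall>u\<in>J. X u w = e u) \<and> Q w})"
    if Q[measurable]: "Measurable.pred M Q" for Q
  proof -
    have "{w \<in> space M. (\<forall>u\<in>J. X u w \<in> D) \<and> Q w}
        = (\<Union>e\<in>PiE J (\<lambda>_. D). {w \<in> space M. (\<forall>u\<in>J. X u w = e u) \<and> Q w})"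
    proof (intro equalityI subsetI)
      fix w assume w: "w \<in> {w \<in> space M. (\<forall>u\<in>J. X u w \<in> D) \<and> Q w}"
      then show "w \<in> (\<Union>e\<in>PiE J (\<lambda>_. D). {w \<in> space M. (\<forall>u\<in>J. X u w = e u) \<and> Q w})"
        by (intro UN_I[of "restrict (\<lambda>u. X u w) J"]) auto
    qed (auto simp: PiE_def)
    moreover have "disjoint_family_on (\<lambda>e. {w \<in> space M. (\<forall>u\<in>J. X u w = e u) \<and> Q w}) (PiE J (\<lambda>_. D))"
    proof (unfold disjoint_family_on_def, intro ballI impI)
      fix e f assume ef: "e \<in> PiE J (\<lambda>_. D)" "f \<in> PiE J (\<lambda>_. D)" "e \<noteq> f"
      then obtain u where "u \<in> J" "e u \<noteq> f u" by (meson PiE_ext)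
      then show "{w \<in> space M. (\<forall>u\<in>J. X u w = e u) \<and> Q w} \<inter> {w \<in> space M. (\<forall>u\<in>J. X u w = f u) \<and> Q w} = {}"
        by auto
    qed
    moreover have "{w \<in> space M. (\<forall>u\<in>J. X u w = e u) \<and> Q w} \<in> events" for e
    proof -
      have [measurable]: "Measurable.pred M (\<lambda>w. \<forall>u\<in>J. X u w = e u)"
        using pred_all_X[of J "\<lambda>u. u" "\<lambda>u v. v = e u"] assms(3) J by simp
      show ?thesis by measurable
    qed
    ultimately show ?thesis using fin
      by (simp add: finite_measure_finite_Union image_subset_iff)
  qed
  have m[measurable]: "Measurable.pred M (\<lambda>w. X s w = x)" "Measurable.pred M (\<lambda>w. X (s + t) w = y)"
    using assms pred_X[of s "\<lambda>v. v = x"] pred_X[of "s + t" "\<lambda>v. v = y"] by simp_all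
  have "prob {w \<in> space M. (\<forall>u\<in>J. X u w \<in> D) \<and> X s w = x \<and> X (s + t) w = y}
      = (\<Sum>e\<in>PiE J (\<lambda>_. D). prob {w \<in> space M. (\<forall>u\<in>J. X u w = e u) \<and> X s w = x \<and> X (s + t) w = y})"
    by (rule split) measurable
  also have "\<dots> = (\<Sum>e\<in>PiE J (\<lambda>_. D). prob {w \<in> space M. (\<forall>u\<in>J. X u w = e u) \<and> X s w = x}) * p t x y"
    unfolding sum_distrib_right by (intro sum.cong refl markov assms)
  also have "(\<Sum>e\<in>PiE J (\<lambda>_. D). prob {w \<in> space M. (\<forall>u\<in>J. X u w = e u) \<and> X s w = x})
      = prob {w \<in> space M. (\<forall>u\<in>J. X u w \<in> D) \<and> X s w = x}"
    by (rule split[symmetric]) measurable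
  finally show ?thesis .
qed

context
  fixes \<epsilon> :: real and D :: "'s set"
  assumes eps: "0 < \<epsilon>" and D: "D \<subseteq> E"
begin

text \<open>Only the times before \<open>k * \<epsilon>\<close> are confined to \<open>D\<close>; the position \<open>x\<close> at time \<open>k * \<epsilon>\<close> may lie outside.\<close>

definition confined :: "nat \<Rightarrow> 's \<Rightarrow> real" where
  "confined k x = prob {w \<in> space M. (\<forall>i<k. X (real i * \<epsilon>) w \<in> D) \<and> X (real k * \<epsilon>) w = x}"

definition survival :: "nat \<Rightarrow> real" where
  "survival k = prob {w \<in> space M. \<forall>i\<le>k. X (real i * \<epsilon>) w \<in> D}"

lemma pred_confined: "Measurable.pred M (\<lambda>w. \<forall>i<k. X (real i * \<epsilon>) w \<in> D)"
proof -
  have "Measurable.pred M (\<lambda>w. \<forall>i\<in>{..<k}. X (real i * \<epsilon>) w \<in> D)"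
    using eps by (intro pred_all_X) auto
  then show ?thesis by (simp only: Ball_def lessThan_iff)
qed

lemma pred_grid: "Measurable.pred M (\<lambda>w. P (X (real k * \<epsilon>) w))"
  using eps by (intro pred_X) simp

lemma confined_events:
  shows "{w \<in> space M. \<forall>i<k. X (real i * \<epsilon>) w \<in> D} \<in> events"
    and "{w \<in> space M. (\<forall>i<k. X (real i * \<epsilon>) w \<in> D) \<and> X (real k * \<epsilon>) w = x} \<in> events"
    and "{w \<in> space M. (\<forall>i<k. X (real i * \<epsilon>) w \<in> D) \<and> X (real k * \<epsilon>) w = x
      \<and> X (real (Suc k) * \<epsilon>) w = y} \<in> events"
proof -
  note sets = pred_confined[of k, unfolded pred_def]
    pred_grid[of "\<lambda>v. v = x" k, unfolded pred_def] pred_grid[of "\<lambda>v. v = y" "Suc k", unfolded pred_def]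
  show "{w \<in> space M. \<forall>i<k. X (real i * \<epsilon>) w \<in> D} \<in> events"
    by (rule sets)
  show "{w \<in> space M. (\<forall>i<k. X (real i * \<epsilon>) w \<in> D) \<and> X (real k * \<epsilon>) w = x} \<in> events"
    by (rule sets.sets_Collect_conj[OF sets(2,1)])
  show "{w \<in> space M. (\<forall>i<k. X (real i * \<epsilon>) w \<in> D) \<and> X (real k * \<epsilon>) w = x
      \<and> X (real (Suc k) * \<epsilon>) w = y} \<in> events"
    by (rule sets.sets_Collect_conj[OF sets.sets_Collect_conj[OF sets(3,2)] sets(1)])
qed

lemma survival_eq: "survival k = (\<Sum>x\<in>D. confined k x)"
proof -
  have "{w \<in> space M. \<forall>i\<le>k. X (real i * \<epsilon>) w \<in> D}
      = (\<Union>x\<in>D. {w \<in> space M. (\<forall>i<k. X (real i * \<epsilon>) w \<in> D) \<and> X (real k * \<epsilon>) w = x})"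
    by (rule set_eqI, simp only: less_Suc_eq_le[symmetric],
        simp only: All_less_Suc mem_Collect_eq UN_iff, blast)
  moreover have "{w \<in> space M. (\<forall>i<k. X (real i * \<epsilon>) w \<in> D) \<and> X (real k * \<epsilon>) w = x} \<in> events" for x
    using confined_events(2)[of k x] .
  then have "prob (\<Union>x\<in>D. {w \<in> space M. (\<forall>i<k. X (real i * \<epsilon>) w \<in> D) \<and> X (real k * \<epsilon>) w = x})
      = (\<Sum>x\<in>D. confined k x)"
    unfolding confined_def
    by (intro finite_measure_finite_Union finite_subset[OF D finite_states] image_subsetI)
       (auto simp only: disjoint_family_on_def)
  ultimately show ?thesis by (simp add: survival_def)
qed

lemma confined_Suc:
  assumes y: "y \<in> E"
  shows "confined (Suc k) y = (\<Sum>x\<in>D. confined k x * p \<epsilon> x y)"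
proof -
  let ?A = "\<lambda>x. {w \<in> space M. (\<forall>i<k. X (real i * \<epsilon>) w \<in> D) \<and> X (real k * \<epsilon>) w = x
      \<and> X (real (Suc k) * \<epsilon>) w = y}"
  have decomp: "{w \<in> space M. (\<forall>i<Suc k. X (real i * \<epsilon>) w \<in> D) \<and> X (real (Suc k) * \<epsilon>) w = y} = (\<Union>x\<in>D. ?A x)"
    using confined_decomposition[of "space M" k "\<lambda>i. X (real i * \<epsilon>)" D "\<lambda>w. X (real (Suc k) * \<epsilon>) w = y"] .
  have "?A x \<in> events" for x
    using confined_events(3)[of k x y] .
  then have "?A ` D \<subseteq> events" by (intro image_subsetI)
  then have additive: "prob (\<Union>x\<in>D. ?A x) = (\<Sum>x\<in>D. prob (?A x))"
    using disjoint_fibres[of "space M" "\<lambda>w. \<forall>i<k. X (real i * \<epsilon>) w \<in> D" "X (real k * \<epsilon>)"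
        "\<lambda>w. X (real (Suc k) * \<epsilon>) w = y" D]
    by (intro finite_measure_finite_Union finite_subset[OF D finite_states])
  have one: "prob (?A x) = confined k x * p \<epsilon> x y" if "x \<in> D" for x
  proof -
    let ?J = "(\<lambda>i. real i * \<epsilon>) ` {..<k}"
    have J: "(\<forall>u\<in>?J. X u w \<in> D) \<longleftrightarrow> (\<forall>i<k. X (real i * \<epsilon>) w \<in> D)" for w
      by blast
    have "real (Suc k) * \<epsilon> = real k * \<epsilon> + \<epsilon>" by (simp add: algebra_simps)
    moreover have "?J \<subseteq> {0..real k * \<epsilon>}" using eps by auto
    then have "prob {w \<in> space M. (\<forall>u\<in>?J. X u w \<in> D) \<and> X (real k * \<epsilon>) w = x \<and> X (real k * \<epsilon> + \<epsilon>) w = y} =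
       prob {w \<in> space M. (\<forall>u\<in>?J. X u w \<in> D) \<and> X (real k * \<epsilon>) w = x} * p \<epsilon> x y"
      by (intro markov_confined D subsetD[OF D that] y) (use eps in auto)
    ultimately show ?thesis unfolding confined_def J by (simp only:)
  qed
  have "confined (Suc k) y = prob (\<Union>x\<in>D. ?A x)"
    unfolding confined_def decomp by (rule refl)
  also have "\<dots> = (\<Sum>x\<in>D. confined k x * p \<epsilon> x y)"
    unfolding additive by (rule sum.cong[OF refl one])
  finally show ?thesis .
qed

lemma confined_nonneg: "0 \<le> confined k x"
  unfolding confined_def by (rule measure_nonneg)

lemma survival_nonneg: "0 \<le> survival k"
  unfolding survival_def by (rule measure_nonneg)

text \<open>If the generator maps \<open>h\<close> to \<open>- 1\<close> on \<open>D\<close>, then one step of length \<open>\<epsilon>\<close> lowers the expectation of \<open>h\<close> on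
the paths that have survived in \<open>D\<close> by \<open>\<epsilon>\<close> times the survival probability, up to a relative error \<open>\<delta>\<close>.
Nothing is lost by the paths that leave \<open>D\<close>, because \<open>h\<close> vanishes there.\<close>

lemma killed_expectation_step:
  fixes h :: "'s \<Rightarrow> real"
  assumes h0: "\<And>x. x \<in> E - D \<Longrightarrow> h x = 0"
    and step: "\<And>x. x \<in> D \<Longrightarrow> \<bar>((\<Sum>y\<in>E. p \<epsilon> x y * h y) - h x) / \<epsilon> + 1\<bar> \<le> \<delta>"
  shows "\<bar>(\<Sum>x\<in>D. confined (Suc k) x * h x) - (\<Sum>x\<in>D. confined k x * h x) + \<epsilon> * survival k\<bar>
     \<le> \<epsilon> * \<delta> * survival k"
proof -
  have "(\<Sum>x\<in>D. confined (Suc k) x * h x) = (\<Sum>y\<in>E. confined (Suc k) y * h y)"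
    using D h0 finite_states by (intro sum.mono_neutral_left) auto
  also have "\<dots> = (\<Sum>y\<in>E. \<Sum>x\<in>D. confined k x * (p \<epsilon> x y * h y))"
    by (intro sum.cong refl) (simp add: confined_Suc sum_distrib_right mult.assoc)
  also have "\<dots> = (\<Sum>x\<in>D. confined k x * (\<Sum>y\<in>E. p \<epsilon> x y * h y))"
    by (subst sum.swap) (simp add: sum_distrib_left)
  finally have next_sum: "(\<Sum>x\<in>D. confined (Suc k) x * h x)
      = (\<Sum>x\<in>D. confined k x * (\<Sum>y\<in>E. p \<epsilon> x y * h y))" .
  have term_eq: "c * (\<epsilon> * ((s - t) / \<epsilon> + 1)) = c * s - c * t + \<epsilon> * c" for c s t
    using eps by (simp add: field_simps)
  have "(\<Sum>x\<in>D. confined (Suc k) x * h x) - (\<Sum>x\<in>D. confined k x * h x) + \<epsilon> * survival k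
      = (\<Sum>x\<in>D. confined k x * (\<epsilon> * (((\<Sum>y\<in>E. p \<epsilon> x y * h y) - h x) / \<epsilon> + 1)))"
    unfolding next_sum survival_eq term_eq by (simp only: sum.distrib sum_subtractf sum_distrib_left[of \<epsilon>])
  also have "\<bar>\<dots>\<bar> \<le> (\<Sum>x\<in>D. confined k x * (\<epsilon> * \<delta>))"
    using eps step
    by (intro order_trans[OF sum_abs] sum_mono)
       (simp add: abs_mult confined_nonneg mult_left_mono)
  also have "\<dots> = \<epsilon> * \<delta> * survival k"
    by (simp add: survival_eq sum_distrib_left mult.commute)
  finally show ?thesis .
qed

text \<open>Telescoping the one-step estimate. The upper bound comes from \<open>h \<ge> 0\<close>; it makes the survival
probabilities summable, hence the remaining expectation tends to \<open>0\<close> and the lower bound follows.\<close>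

lemma survival_sum_bounds:
  fixes h :: "'s \<Rightarrow> real"
  assumes h0: "\<And>x. x \<in> E - D \<Longrightarrow> h x = 0" and h_nonneg: "\<And>x. x \<in> E \<Longrightarrow> 0 \<le> h x"
    and step: "\<And>x. x \<in> D \<Longrightarrow> \<bar>((\<Sum>y\<in>E. p \<epsilon> x y * h y) - h x) / \<epsilon> + 1\<bar> \<le> \<delta>"
    and \<delta>: "0 \<le> \<delta>" "\<delta> < 1" and start: "(\<Sum>x\<in>D. confined 0 x * h x) = v"
  shows survival_summable: "summable survival"
    and survival_suminf_le: "\<epsilon> * suminf survival \<le> v / (1 - \<delta>)"
    and survival_suminf_ge: "v / (1 + \<delta>) \<le> \<epsilon> * suminf survival"
proof -
  define a where "a k = (\<Sum>x\<in>D. confined k x * h x)" for k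
  have a_nonneg: "0 \<le> a k" for k
    unfolding a_def using D h_nonneg by (intro sum_nonneg mult_nonneg_nonneg confined_nonneg) auto
  have step': "\<bar>a (Suc k) - a k + \<epsilon> * survival k\<bar> \<le> \<epsilon> * \<delta> * survival k" for k
    unfolding a_def using killed_expectation_step[OF h0 step] .
  have up: "(\<epsilon> * (1 - \<delta>)) * (\<Sum>k<K. survival k) \<le> v - a K" for K
  proof (induction K)
    case (Suc K)
    then show ?case using step'[of K] by (simp add: algebra_simps abs_le_iff)
  qed (simp add: a_def start)
  have lo: "v - a K \<le> (\<epsilon> * (1 + \<delta>)) * (\<Sum>k<K. survival k)" for K
  proof (induction K)
    case (Suc K)
    then show ?case using step'[of K] by (simp add: algebra_simps abs_le_iff)
  qed (simp add: a_def start)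
  have bound: "(\<Sum>k<K. survival k) \<le> v / (\<epsilon> * (1 - \<delta>))" for K
    using up[of K] a_nonneg[of K] eps \<delta> by (simp add: pos_le_divide_eq mult.commute)
  show summable: "summable survival"
    by (rule summableI_nonneg_bounded[OF survival_nonneg bound])
  show "\<epsilon> * suminf survival \<le> v / (1 - \<delta>)"
    using suminf_le_const[OF summable bound] eps \<delta> by (simp add: field_simps)
  have "a \<longlonglongrightarrow> 0"
  proof (rule tendsto_sandwich[OF _ _ tendsto_const])
    have "a k \<le> survival k * (\<Sum>x\<in>D. h x)" for k
    proof -
      have "confined k x * h x \<le> survival k * h x" if "x \<in> D" for x
        using that D h_nonneg finite_subset[OF D finite_states] unfolding survival_eq
        by (intro mult_right_mono member_le_sum confined_nonneg) auto
      then show ?thesis unfolding a_def sum_distrib_left by (rule sum_mono)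
    qed
    then show "\<forall>\<^sub>F k in sequentially. a k \<le> survival k * (\<Sum>x\<in>D. h x)" by simp
    show "(\<lambda>k. survival k * (\<Sum>x\<in>D. h x)) \<longlonglongrightarrow> 0"
      using tendsto_mult_right[OF summable_LIMSEQ_zero[OF summable]] by simp
  qed (simp add: a_nonneg)
  then have "(\<lambda>K. v - a K) \<longlonglongrightarrow> v - 0" by (intro tendsto_intros)
  moreover have "(\<lambda>K. (\<epsilon> * (1 + \<delta>)) * (\<Sum>k<K. survival k)) \<longlonglongrightarrow> (\<epsilon> * (1 + \<delta>)) * suminf survival"
    by (intro tendsto_intros summable_LIMSEQ[OF summable])
  ultimately have "v - 0 \<le> (\<epsilon> * (1 + \<delta>)) * suminf survival"
    by (rule LIMSEQ_le) (use lo in auto)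
  then show "v / (1 + \<delta>) \<le> \<epsilon> * suminf survival"
    using \<delta> by (simp add: field_simps)
qed

lemma grid_hitting_time_survival:
  shows grid_hitting_time_measurable: "grid_hitting_time X (E - D) \<epsilon> \<in> borel_measurable M"
    and nn_integral_grid_hitting_time: "summable survival \<Longrightarrow>
      (\<integral>\<^sup>+ w. grid_hitting_time X (E - D) \<epsilon> w \<partial>M) = ennreal (\<epsilon> * suminf survival)"
proof -
  let ?A = "\<lambda>k. {w \<in> space M. \<forall>i\<le>k. X (real i * \<epsilon>) w \<in> D}"
  have A: "?A k \<in> events" for k
    using confined_events(1)[of "Suc k"] by (simp only: less_Suc_eq_le)
  have eq: "grid_hitting_time X (E - D) \<epsilon> w = (\<Sum>k. ennreal \<epsilon> * indicator (?A k) w)"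
    if "w \<in> space M" for w
  proof -
    have "X (real i * \<epsilon>) w \<notin> E - D \<longleftrightarrow> X (real i * \<epsilon>) w \<in> D" for i
      using X_in[of "real i * \<epsilon>" w] eps that D by auto
    then show ?thesis using that
      by (simp add: grid_hitting_time_eq_suminf[OF eps] indicator_def of_bool_def)
  qed
  show "grid_hitting_time X (E - D) \<epsilon> \<in> borel_measurable M"
    by (subst measurable_cong[OF eq], assumption, rule measurable_suminf_indicator[OF A])
  assume summable: "summable survival"
  have "(\<integral>\<^sup>+ w. grid_hitting_time X (E - D) \<epsilon> w \<partial>M)
      = (\<integral>\<^sup>+ w. (\<Sum>k. ennreal \<epsilon> * indicator (?A k) w) \<partial>M)"
    by (rule nn_integral_cong) (rule eq)
  also have "\<dots> = (\<Sum>k. ennreal \<epsilon> * emeasure M (?A k))"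
    by (rule nn_integral_suminf_indicator[OF A])
  also have "\<dots> = (\<Sum>k. ennreal (\<epsilon> * survival k))"
    unfolding survival_def emeasure_eq_measure ennreal_mult[OF less_imp_le[OF eps] measure_nonneg]
    by (rule refl)
  also have "\<dots> = ennreal (\<epsilon> * suminf survival)"
    using eps summable by (subst suminf_ennreal2) (auto simp: survival_nonneg suminf_mult summable_mult)
  finally show "(\<integral>\<^sup>+ w. grid_hitting_time X (E - D) \<epsilon> w \<partial>M) = ennreal (\<epsilon> * suminf survival)" .
qed

end

text \<open>Along the grids of mesh \<open>e / 2 ^ n\<close> the discretised hitting times decrease to the hitting time, while
their expectations are squeezed to \<open>h a\<close>; monotone convergence identifies the two limits.\<close>

lemma nn_integral_hitting_time:
  fixes h :: "'s \<Rightarrow> real"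
  assumes gen: "has_generator E p L" and B: "B \<subseteq> E" and a: "a \<in> E" and start: "AE w in M. X 0 w = a"
    and h_nonneg: "\<And>x. x \<in> E \<Longrightarrow> 0 \<le> h x" and h0: "\<And>x. x \<in> B \<Longrightarrow> h x = 0"
    and Lh: "\<And>x. x \<in> E - B \<Longrightarrow> L h x = - 1"
  shows "(\<integral>\<^sup>+ w. hitting_time X B w \<partial>M) = ennreal (h a)"
proof -
  define D where "D = E - B"
  have D: "D \<subseteq> E" and ED: "E - D = B" using B by (auto simp: D_def)
  have finD: "finite D" using D finite_states finite_subset by blast
  have small: "\<exists>e>0. \<forall>\<epsilon>. 0 < \<epsilon> \<longrightarrow> \<epsilon> < e \<longrightarrow>
      (\<forall>x\<in>D. \<bar>((\<Sum>y\<in>E. p \<epsilon> x y * h y) - h x) / \<epsilon> + 1\<bar> \<le> \<delta>)" if \<delta>: "0 < \<delta>" for \<delta>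
  proof -
    have "\<forall>\<^sub>F \<epsilon> in at_right 0. \<forall>x\<in>D. \<bar>((\<Sum>y\<in>E. p \<epsilon> x y * h y) - h x) / \<epsilon> + 1\<bar> \<le> \<delta>"
    proof (rule eventually_ball_finite[OF finD], intro ballI)
      fix x assume x: "x \<in> D"
      then have "((\<lambda>t. ((\<Sum>y\<in>E. p t x y * h y) - h x) / t) \<longlongrightarrow> - 1) (at_right 0)"
      proof -
        have "x \<in> E" and "L h x = - 1" using x D Lh[of x] by (auto simp: D_def)
        then show ?thesis
          using bspec[OF spec[OF gen[unfolded has_generator_def], of h], of x] by (simp only:)
      qed
      from tendstoD[OF this \<delta>]
      show "\<forall>\<^sub>F \<epsilon> in at_right 0. \<bar>((\<Sum>y\<in>E. p \<epsilon> x y * h y) - h x) / \<epsilon> + 1\<bar> \<le> \<delta>"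
        by eventually_elim (simp add: dist_real_def)
    qed
    then show ?thesis by (auto simp: eventually_at_right_field)
  qed
  have v: "(\<Sum>x\<in>D. confined \<epsilon> D 0 x * h x) = h a" if "0 < \<epsilon>" for \<epsilon>
  proof -
    have "confined \<epsilon> D 0 x = (if x = a then 1 else 0)" for x
    proof -
      have "prob {w \<in> space M. X 0 w = x} = (if x = a then 1 else 0)"
      proof (cases "x = a")
        case True
        have "{w \<in> space M. X 0 w = x} \<in> events" using pred_X[of 0 "\<lambda>y. y = x"] by (simp add: pred_def)
        then show ?thesis using start True by (simp add: prob_Collect_eq_1)
      next
        case False
        have "{w \<in> space M. X 0 w = x} \<in> events" using pred_X[of 0 "\<lambda>y. y = x"] by (simp add: pred_def)
        moreover have "AE w in M. X 0 w \<noteq> x" using start by eventually_elim (use False in auto)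
        ultimately show ?thesis using False by (simp add: prob_Collect_eq_0)
      qed
      then show ?thesis by (simp add: confined_def[OF that D])
    qed
    then have "(\<Sum>x\<in>D. confined \<epsilon> D 0 x * h x) = (if a \<in> D then h a else 0)"
      using finD by (simp add: mult_delta_left)
    also have "\<dots> = h a" using a h0[of a] by (auto simp: D_def)
    finally show ?thesis .
  qed
  \<comment> \<open>An error of at most \<open>1/2\<close> on the coarsest grid makes the first expectation finite, as decreasing monotone convergence requires.\<close>
  obtain e1 where e1: "0 < e1" "\<And>\<epsilon> x. 0 < \<epsilon> \<Longrightarrow> \<epsilon> < e1 \<Longrightarrow> x \<in> D \<Longrightarrow> 
      \<bar>((\<Sum>y\<in>E. p \<epsilon> x y * h y) - h x) / \<epsilon> + 1\<bar> \<le> 1/2"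
    using small[of "1/2"] by auto
  define g where "g n = e1 / 2 / 2 ^ n" for n :: nat
  have g: "0 < g n" "g n < e1" for n
  proof -
    have "e1 / 2 / 2 ^ n \<le> e1 / 2 / 1" using e1(1) by (intro divide_left_mono) auto
    then show "0 < g n" "g n < e1" using e1(1) by (auto simp: g_def)
  qed
  define V where "V n = g n * suminf (survival (g n) D)" for n
  have ED0: "\<And>x. x \<in> E - D \<Longrightarrow> h x = 0" using h0 ED by auto
  have summable: "summable (survival (g n) D)" for n
    using survival_summable[OF g(1) D ED0 h_nonneg e1(2)[OF g] _ _ v[OF g(1)]] by simp
  have int: "(\<integral>\<^sup>+ w. grid_hitting_time X B (g n) w \<partial>M) = ennreal (V n)" for n
    using nn_integral_grid_hitting_time[OF g(1) D summable] by (simp add: ED V_def)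
  have V_lim: "V \<longlonglongrightarrow> h a"
  proof -
    have *: "\<forall>\<^sub>F n in sequentially. h a / (1 + \<delta>) \<le> V n \<and> V n \<le> h a / (1 - \<delta>)"
      if \<delta>: "0 < \<delta>" "\<delta> < 1" for \<delta>
    proof -
      obtain e where e: "0 < e" "\<And>\<epsilon> x. 0 < \<epsilon> \<Longrightarrow> \<epsilon> < e \<Longrightarrow> x \<in> D \<Longrightarrow> 
          \<bar>((\<Sum>y\<in>E. p \<epsilon> x y * h y) - h x) / \<epsilon> + 1\<bar> \<le> \<delta>"
        using small[OF \<delta>(1)] by auto
      have "g \<longlonglongrightarrow> 0" 
      proof -
        have "(\<lambda>n. e1 / 2 * (1 / 2) ^ n) \<longlonglongrightarrow> e1 / 2 * 0"
          by (intro tendsto_intros LIMSEQ_realpow_zero) auto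
        then show ?thesis by (simp add: g_def[abs_def] power_one_over)
      qed
      then have "\<forall>\<^sub>F n in sequentially. g n < e" using e(1) by (rule order_tendstoD)
      then show ?thesis
      proof eventually_elim
        case (elim n)
        show ?case unfolding V_def
          using survival_suminf_le[OF g(1) D ED0 h_nonneg e(2)[OF g(1) elim] _ _ v[OF g(1)]]
            survival_suminf_ge[OF g(1) D ED0 h_nonneg e(2)[OF g(1) elim] _ _ v[OF g(1)]] \<delta> by simp
      qed
    qed
    show ?thesis
    proof (rule order_tendstoI)
      fix y assume y: "y < h a"
      have "((\<lambda>\<delta>. h a / (1 + \<delta>)) \<longlongrightarrow> h a / (1 + 0)) (at_right 0)"
        by (intro tendsto_intros) auto
      then have "\<forall>\<^sub>F \<delta> in at_right 0. y < h a / (1 + \<delta>)" using y by (intro order_tendstoD) auto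
      moreover have "\<forall>\<^sub>F \<delta> in at_right 0. 0 < \<delta> \<and> \<delta> < (1::real)"
        using eventually_at_right_real[of 0 1] by auto
      ultimately obtain \<delta> where "y < h a / (1 + \<delta>)" "0 < \<delta>" "\<delta> < 1"
        using eventually_happens'[OF trivial_limit_at_right_real eventually_conj] by blast
      then show "\<forall>\<^sub>F n in sequentially. y < V n" using *[of \<delta>]
        by (auto elim!: eventually_mono)
    next
      fix y assume y: "h a < y"
      have "((\<lambda>\<delta>. h a / (1 - \<delta>)) \<longlongrightarrow> h a / (1 - 0)) (at_right 0)"
        by (intro tendsto_intros) auto
      then have "\<forall>\<^sub>F \<delta> in at_right 0. h a / (1 - \<delta>) < y" using y by (intro order_tendstoD) auto
      moreover have "\<forall>\<^sub>F \<delta> in at_right 0. 0 < \<delta> \<and> \<delta> < (1::real)"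
        using eventually_at_right_real[of 0 1] by auto
      ultimately obtain \<delta> where "h a / (1 - \<delta>) < y" "0 < \<delta>" "\<delta> < 1"
        using eventually_happens'[OF trivial_limit_at_right_real eventually_conj] by blast
      then show "\<forall>\<^sub>F n in sequentially. V n < y" using *[of \<delta>]
        by (auto elim!: eventually_mono)
    qed
  qed
  have dec: "decseq (\<lambda>n w. grid_hitting_time X B (g n) w)"
  proof (subst decseq_Suc_iff, intro allI le_funI)
    fix n w
    have "g (Suc n) = g n / 2" by (simp add: g_def)
    then show "grid_hitting_time X B (g (Suc n)) w \<le> grid_hitting_time X B (g n) w"
      by (simp only: grid_hitting_time_halve)
  qed
  have "(\<integral>\<^sup>+ w. hitting_time X B w \<partial>M) = (\<integral>\<^sup>+ w. (INF n. grid_hitting_time X B (g n) w) \<partial>M)"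
    unfolding g_def using e1(1)
    by (intro nn_integral_cong hitting_time_eq_INF_grid right_continuous) auto
  also have "\<dots> = (INF n. \<integral>\<^sup>+ w. grid_hitting_time X B (g n) w \<partial>M)"
    using grid_hitting_time_measurable[OF g(1) D] dec
    by (intro nn_integral_monotone_convergence_INF_decseq[where i = 0]) (auto simp: ED int)
  also have "\<dots> = (INF n. ennreal (V n))" by (simp add: int)
  also have "\<dots> = ennreal (h a)"
  proof -
    have "decseq (\<lambda>n. ennreal (V n))"
      unfolding int[symmetric] decseq_def
      by (intro allI impI nn_integral_mono le_funD[OF decseqD[OF dec]])
    from LIMSEQ_INF[OF this] tendsto_ennrealI[OF V_lim] show ?thesis
      by (rule LIMSEQ_unique)
  qed
  finally show ?thesis .
qed

end

lemma markov_process_expected_hitting_time: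
  fixes h :: "'s \<Rightarrow> real"
  assumes "markov_process E L M X" and B: "B \<subseteq> E" and "a \<in> E" and start: "AE w in M. X 0 w = a"
    and h: "\<And>x. x \<in> E \<Longrightarrow> 0 \<le> h x" "\<And>x. x \<in> B \<Longrightarrow> h x = 0" "\<And>x. x \<in> E - B \<Longrightarrow> L h x = - 1"
  shows "(\<integral>\<^sup>+ w. hitting_time X B w \<partial>M) = ennreal (h a)"
proof -
  note process = assms(1)[unfolded markov_process_def]
  note fin = process[THEN conjunct1]
    and prob = process[THEN conjunct2, THEN conjunct1]
    and meas = process[THEN conjunct2, THEN conjunct2, THEN conjunct1]
    and rc = process[THEN conjunct2, THEN conjunct2, THEN conjunct2, THEN conjunct1]
  from process obtain p where p: "has_generator E p L"
    and mk: "\<forall>s\<ge>0. \<forall>t\<ge>0. \<forall>J e. \<forall>x\<in>E. \<forall>y\<in>E. finite J \<and> J \<subseteq> {0..s} \<longrightarrow>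
          measure M {w \<in> space M. (\<forall>u\<in>J. X u w = e u) \<and> X s w = x \<and> X (s + t) w = y} =
          measure M {w \<in> space M. (\<forall>u\<in>J. X u w = e u) \<and> X s w = x} * p t x y"
    by (elim conjE exE) (rule that; assumption)
  interpret prob_space M by (rule prob)
  interpret finite_markov M E X p
  proof
    fix s t :: real and J e x y
    assume "0 \<le> s" "0 \<le> t" "finite J" "J \<subseteq> {0..s}" "x \<in> E" "y \<in> E"
    with mk[rule_format, of s t x y J e] show
      "measure M {w \<in> space M. (\<forall>u\<in>J. X u w = e u) \<and> X s w = x \<and> X (s + t) w = y} =
       measure M {w \<in> space M. (\<forall>u\<in>J. X u w = e u) \<and> X s w = x} * p t x y"
      by (simp only:)
  qed (use fin meas rc in \<open>simp_all only:\<close>)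
  show ?thesis by (rule nn_integral_hitting_time[OF p B assms(3) start h])
qed

section \<open>Weights of single sites\<close>

text \<open>The coefficient of \<open>x ^ k\<close> in \<open>(1 - x) powr (- d)\<close>: the single-site factor of the reversible measure of
the inclusion process, for site parameter \<open>1\<close>.\<close>

definition inclusion_weight :: "real \<Rightarrow> nat \<Rightarrow> real" where
  "inclusion_weight d k = pochhammer d k / fact k"

lemma inclusion_weight_0 [simp]: "inclusion_weight d 0 = 1"
  by (simp add: inclusion_weight_def)

lemma inclusion_weight_Suc:
  "real (Suc k) * inclusion_weight d (Suc k) = (d + real k) * inclusion_weight d k"
  by (simp add: inclusion_weight_def pochhammer_Suc field_simps del: of_nat_Suc)

lemma inclusion_weight_pos: "0 < d \<Longrightarrow> 0 < inclusion_weight d k"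
  by (simp add: inclusion_weight_def pochhammer_pos)

lemma inclusion_weight_ge:
  assumes "0 < d" "1 \<le> k"
  shows "d / real k \<le> inclusion_weight d k"
  using assms(2)
proof (induction k rule: nat_induct_at_least)
  case base
  show ?case using inclusion_weight_Suc[of 0 d] by simp
next
  case (Suc k)
  have "d \<le> real k * inclusion_weight d k" using Suc by (simp add: field_simps)
  also have "\<dots> \<le> (d + real k) * inclusion_weight d k"
    using assms(1) inclusion_weight_pos[OF assms(1), of k] by (intro mult_right_mono) auto
  also have "\<dots> = real (Suc k) * inclusion_weight d (Suc k)" by (rule inclusion_weight_Suc[symmetric])
  finally show ?case by (simp add: field_simps)
qed

text \<open>The left-hand side is \<open>d\<close> times the product of \<open>1 + d / j\<close> over \<open>1 \<le> j \<le> k\<close>, which is at most the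
exponential of \<open>d\<close> times a harmonic sum.\<close>

lemma inclusion_weight_Suc_le_exp:
  assumes "0 < d" "1 \<le> k"
  shows "real (Suc k) * inclusion_weight d (Suc k) \<le> d * exp (d * (1 + ln (real k)))"
  using assms(2)
proof (induction k rule: nat_induct_at_least)
  case base
  have "real (Suc 1) * inclusion_weight d (Suc 1) = (1 + d) * d"
    using inclusion_weight_Suc[of 1 d] inclusion_weight_Suc[of 0 d] by simp
  also have "\<dots> \<le> exp d * d" using assms by (intro mult_right_mono exp_ge_add_one_self) auto
  finally show ?case by (simp add: mult.commute)
next
  case (Suc k)
  have "ln (1 - 1 / real (Suc k)) \<le> - (1 / real (Suc k))"
    using ln_le_minus_one[of "1 - 1 / real (Suc k)"] Suc(1) by simp
  moreover have "1 - 1 / real (Suc k) = real k / real (Suc k)" by (simp add: field_simps)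
  ultimately have ln: "ln (real k) + 1 / real (Suc k) \<le> ln (real (Suc k))"
    using Suc(1) by (simp add: ln_div)
  have "real (Suc (Suc k)) * inclusion_weight d (Suc (Suc k)) = (d + real (Suc k)) * inclusion_weight d (Suc k)"
    by (rule inclusion_weight_Suc)
  also have "\<dots> = (1 + d / real (Suc k)) * (real (Suc k) * inclusion_weight d (Suc k))"
    by (simp add: field_simps del: of_nat_Suc)
  also have "\<dots> \<le> exp (d / real (Suc k)) * (d * exp (d * (1 + ln (real k))))"
    using inclusion_weight_pos[OF assms(1), of "Suc k"]
    by (intro mult_mono[OF exp_ge_add_one_self Suc.IH]) simp_all
  also have "\<dots> = d * exp (d * (1 + (ln (real k) + 1 / real (Suc k))))"
    by (simp add: algebra_simps flip: exp_add)
  also have "\<dots> \<le> d * exp (d * (1 + ln (real (Suc k))))"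
    using assms(1) ln by simp
  finally show ?case .
qed

text \<open>Together with the lower bound \<open>d / k\<close> this shows that, as long as \<open>d * ln N\<close> is small, a pile of \<open>k\<close>
particles has weight of order \<open>d / k\<close>, uniformly in \<open>k \<le> N\<close>.\<close>

lemma inclusion_weight_le:
  assumes "0 < d" "1 \<le> k" "k \<le> N" "d * (1 + ln (real N)) \<le> 1"
  shows "inclusion_weight d k \<le> 3 * d / real k"
proof (cases "k = 1")
  case True
  then show ?thesis using inclusion_weight_Suc[of 0 d] assms(1) by simp
next
  case False
  with assms obtain j where j: "k = Suc j" "1 \<le> j" by (cases k) auto
  have "real k * inclusion_weight d k \<le> d * exp (d * (1 + ln (real j)))"
    using inclusion_weight_Suc_le_exp[OF assms(1) j(2)] j by simp
  also have "\<dots> \<le> d * exp 1"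
  proof -
    have "d * (1 + ln (real j)) \<le> d * (1 + ln (real N))"
      using assms j by (intro mult_left_mono) auto
    then have "d * (1 + ln (real j)) \<le> 1" using assms(4) by linarith
    then show ?thesis using assms by simp
  qed
  also have "\<dots> \<le> d * 3" using assms exp_le by (intro mult_left_mono) auto
  finally show ?thesis using assms by (simp add: field_simps)
qed

text \<open>Vandermonde's identity for rising factorials: merging two sites adds their parameters \<open>d\<close>.\<close>

lemma inclusion_weight_convolution:
  "(\<Sum>j\<le>n. inclusion_weight a j * inclusion_weight b (n - j)) = inclusion_weight (a + b) n"
proof -
  have "inclusion_weight (a + b) n = (\<Sum>j\<le>n. of_nat (n choose j) * pochhammer a j * pochhammer b (n - j)) / fact n"
    by (simp add: inclusion_weight_def pochhammer_binomial_sum)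
  also have "\<dots> = (\<Sum>j\<le>n. inclusion_weight a j * inclusion_weight b (n - j))"
    unfolding sum_divide_distrib
    by (intro sum.cong refl) (simp add: inclusion_weight_def binomial_fact)
  finally show ?thesis by simp
qed

section \<open>Sums over configurations\<close>

lemma configs_empty: "configs {} n = (if n = 0 then {\<lambda>_. 0} else {})"
  by (auto simp: configs_def)

lemma configs_insert:
  assumes "finite S" "x \<notin> S"
  shows "bij_betw (\<lambda>(j, \<zeta>). \<zeta>(x := j)) (SIGMA j:{..n}. configs S (n - j)) (configs (insert x S) n)"
proof (rule bij_betw_byWitness[where f' = "\<lambda>\<eta>. (\<eta> x, \<eta>(x := 0))"])
  have *: "(\<Sum>y\<in>S. (if y = x then k else \<eta> y)) = (\<Sum>y\<in>S. \<eta> y)" for \<eta> and k :: nat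
    using assms by (intro sum.cong) auto
  show "\<forall>a\<in>SIGMA j:{..n}. configs S (n - j). (\<lambda>\<eta>. (\<eta> x, \<eta>(x := 0))) (case a of (j, \<zeta>) \<Rightarrow> \<zeta>(x := j)) = a"
    using assms by (auto simp: configs_def fun_eq_iff)
  show "\<forall>\<eta>\<in>configs (insert x S) n. (case (\<eta> x, \<eta>(x := 0)) of (j, \<zeta>) \<Rightarrow> \<zeta>(x := j)) = \<eta>"
    by auto
  show "(\<lambda>(j, \<zeta>). \<zeta>(x := j)) ` (SIGMA j:{..n}. configs S (n - j)) \<subseteq> configs (insert x S) n"
    using assms by (auto simp: configs_def *)
  show "(\<lambda>\<eta>. (\<eta> x, \<eta>(x := 0))) ` configs (insert x S) n \<subseteq> (SIGMA j:{..n}. configs S (n - j))"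
    using assms by (auto simp: configs_def *)
qed

lemma finite_configs: "finite S \<Longrightarrow> finite (configs S n)"
proof (induction S arbitrary: n rule: finite_induct)
  case empty
  then show ?case by (simp add: configs_empty)
next
  case (insert x S)
  then show ?case
    using bij_betw_finite[OF configs_insert[OF insert.hyps(1,2), of n]] by auto
qed

lemma sum_configs_insert:
  assumes "finite S" "x \<notin> S"
  shows "(\<Sum>\<eta>\<in>configs (insert x S) n. G \<eta>) = (\<Sum>j\<le>n. \<Sum>\<zeta>\<in>configs S (n - j). G (\<zeta>(x := j)))"
proof -
  have "(\<Sum>\<eta>\<in>configs (insert x S) n. G \<eta>)
      = (\<Sum>(j, \<zeta>)\<in>(SIGMA j:{..n}. configs S (n - j)). G (\<zeta>(x := j)))"
    using sum.reindex_bij_betw[OF configs_insert[OF assms, of n], of G] by (simp add: split_def)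
  then show ?thesis using assms(1) by (simp add: sum.Sigma finite_configs)
qed

lemma sum_configs_prod_weight:
  assumes "finite S"
  shows "(\<Sum>\<eta>\<in>configs S n. \<Prod>x\<in>S. inclusion_weight d (\<eta> x)) = inclusion_weight (real (card S) * d) n"
  using assms
proof (induction S arbitrary: n rule: finite_induct)
  case empty
  then show ?case by (simp add: configs_empty inclusion_weight_def pochhammer_0_left)
next
  case (insert x S)
  have "(\<Prod>y\<in>S. inclusion_weight d ((\<zeta>(x := j)) y)) = (\<Prod>y\<in>S. inclusion_weight d (\<zeta> y))" for \<zeta> j
    using insert.hyps by (intro prod.cong) auto
  then have "(\<Sum>\<eta>\<in>configs (insert x S) n. \<Prod>x\<in>insert x S. inclusion_weight d (\<eta> x))
      = (\<Sum>j\<le>n. inclusion_weight d j * inclusion_weight (real (card S) * d) (n - j))"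
    using insert.hyps by (simp add: sum_configs_insert sum_distrib_left[symmetric] insert.IH fun_upd_same del: fun_upd_apply) 
  then show ?case using insert.hyps
    by (simp add: inclusion_weight_convolution algebra_simps)
qed

definition add_particle :: "('a \<Rightarrow> nat) \<Rightarrow> 'a \<Rightarrow> 'a \<Rightarrow> nat" where
  "add_particle \<xi> x = \<xi>(x := Suc (\<xi> x))"

lemma sum_add_particle:
  assumes "finite S" "x \<in> S"
  shows "(\<Sum>y\<in>S. add_particle \<xi> x y) = Suc (\<Sum>y\<in>S. \<xi> y)"
proof -
  have "(\<Sum>y\<in>S - {x}. add_particle \<xi> x y) = (\<Sum>y\<in>S - {x}. \<xi> y)"
    by (intro sum.cong) (auto simp: add_particle_def)
  then show ?thesis using assms by (simp add: sum.remove[of S x] add_particle_def)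
qed

lemma add_particle_configs:
  "finite S \<Longrightarrow> x \<in> S \<Longrightarrow> \<xi> \<in> configs S n \<Longrightarrow> add_particle \<xi> x \<in> configs S (Suc n)"
  by (simp add: configs_def sum_add_particle) (auto simp: add_particle_def)

lemma add_particle_surj:
  assumes "finite S" "x \<in> S" "\<eta> \<in> configs S (Suc n)" "0 < \<eta> x"
  shows "\<eta>(x := \<eta> x - 1) \<in> configs S n" "add_particle (\<eta>(x := \<eta> x - 1)) x = \<eta>"
proof -
  show 1: "add_particle (\<eta>(x := \<eta> x - 1)) x = \<eta>"
    using assms(4) by (auto simp: add_particle_def)
  show "\<eta>(x := \<eta> x - 1) \<in> configs S n"
    using sum_add_particle[OF assms(1,2), of "\<eta>(x := \<eta> x - 1)"] assms(2,3) unfolding 1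
    by (auto simp: configs_def)
qed

lemma sum_configs_add_particle:
  assumes "finite S" "x \<in> S" and zero: "\<And>\<eta>. \<eta> \<in> configs S (Suc n) \<Longrightarrow> \<eta> x = 0 \<Longrightarrow> H \<eta> = 0"
  shows "(\<Sum>\<eta>\<in>configs S (Suc n). H \<eta>) = (\<Sum>\<xi>\<in>configs S n. H (add_particle \<xi> x))"
proof -
  have "(\<Sum>\<eta>\<in>configs S (Suc n). H \<eta>) = (\<Sum>\<eta>\<in>{\<eta> \<in> configs S (Suc n). 0 < \<eta> x}. H \<eta>)"
    using assms by (intro sum.mono_neutral_right finite_configs) auto
  also have "\<dots> = (\<Sum>\<xi>\<in>configs S n. H (add_particle \<xi> x))"
    by (rule sum.reindex_bij_witness[of _ "\<lambda>\<xi>. add_particle \<xi> x" "\<lambda>\<eta>. \<eta>(x := \<eta> x - 1)"])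
       (use assms in \<open>auto simp: add_particle_surj add_particle_configs simp del: One_nat_def\<close>,
        auto simp: add_particle_def)
  finally show ?thesis .
qed

section \<open>The inclusion process as a network\<close>

text \<open>The function \<open>\<alpha>\<close> is any positive reversible measure of the walk. It need not be a probability
measure, so that it can be normalised to be \<open>1\<close> at the sites where it is maximal.\<close>

locale inclusion_setting =
  fixes S :: "'a set" and r :: "'a \<Rightarrow> 'a \<Rightarrow> real" and \<alpha> :: "'a \<Rightarrow> real" and d :: real
  assumes finite_S: "finite S" and S_nonempty: "S \<noteq> {}"
    and rate_nonneg: "x \<in> S \<Longrightarrow> y \<in> S \<Longrightarrow> 0 \<le> r x y"
    and rate_diag: "x \<in> S \<Longrightarrow> r x x = 0"
    and irreducible_walk: "x \<in> S \<Longrightarrow> y \<in> S \<Longrightarrow> (x, y) \<in> {(a, b). a \<in> S \<and> b \<in> S \<and> 0 < r a b}\<^sup>*"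
    and \<alpha>_pos: "x \<in> S \<Longrightarrow> 0 < \<alpha> x"
    and balance: "x \<in> S \<Longrightarrow> y \<in> S \<Longrightarrow> \<alpha> x * r x y = \<alpha> y * r y x"
    and d_pos: "0 < d"
begin

definition weight :: "('a \<Rightarrow> nat) \<Rightarrow> real" where
  "weight \<eta> = (\<Prod>x\<in>S. \<alpha> x ^ \<eta> x * inclusion_weight d (\<eta> x))"

lemma weight_pos: "0 < weight \<eta>"
  unfolding weight_def by (intro prod_pos ballI mult_pos_pos zero_less_power \<alpha>_pos inclusion_weight_pos d_pos)

lemma weight_add_particle:
  assumes "x \<in> S"
  shows "weight (add_particle \<xi> x) * real (Suc (\<xi> x)) = weight \<xi> * (d + real (\<xi> x)) * \<alpha> x"
proof -
  have "(\<Prod>y\<in>S - {x}. \<alpha> y ^ add_particle \<xi> x y * inclusion_weight d (add_particle \<xi> x y))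
      = (\<Prod>y\<in>S - {x}. \<alpha> y ^ \<xi> y * inclusion_weight d (\<xi> y))" (is "_ = ?P")
    by (intro prod.cong) (auto simp: add_particle_def)
  then have "weight (add_particle \<xi> x) * real (Suc (\<xi> x))
      = \<alpha> x ^ Suc (\<xi> x) * (real (Suc (\<xi> x)) * inclusion_weight d (Suc (\<xi> x))) * ?P"
    using assms finite_S
    by (simp add: weight_def prod.remove[of S x] add_particle_def del: of_nat_Suc)
  also have "\<dots> = weight \<xi> * (d + real (\<xi> x)) * \<alpha> x"
    unfolding inclusion_weight_Suc
    using assms finite_S by (simp add: weight_def prod.remove[of S x])
  finally show ?thesis .
qed

text \<open>An edge is labelled by the configuration \<open>\<xi>\<close> of the \<open>n\<close> particles that stay and by the old and the new
site of the particle that moves. In these coordinates the conductance is visibly symmetric in the two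
sites. The factor \<open>1 / 2\<close> compensates for each edge occurring in both orientations.\<close>

definition conductance :: "('a \<Rightarrow> nat) \<times> 'a \<times> 'a \<Rightarrow> real" where
  "conductance = (\<lambda>(\<xi>, x, y). weight \<xi> * (d + real (\<xi> x)) * (d + real (\<xi> y)) * \<alpha> x * r x y / 2)"

lemma conductance_nonneg: "x \<in> S \<Longrightarrow> y \<in> S \<Longrightarrow> 0 \<le> conductance (\<xi>, x, y)"
  unfolding conductance_def
  by (auto intro!: mult_nonneg_nonneg less_imp_le[OF weight_pos] less_imp_le[OF \<alpha>_pos] rate_nonneg
      simp: d_pos less_imp_le)

lemma conductance_commute: "x \<in> S \<Longrightarrow> y \<in> S \<Longrightarrow> conductance (\<xi>, x, y) = conductance (\<xi>, y, x)"
  unfolding conductance_def using balance[of x y] by (simp add: mult.assoc mult.left_commute)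

definition edge_src :: "('a \<Rightarrow> nat) \<times> 'a \<times> 'a \<Rightarrow> 'a \<Rightarrow> nat" where
  "edge_src = (\<lambda>(\<xi>, x, y). add_particle \<xi> x)"

definition edge_tgt :: "('a \<Rightarrow> nat) \<times> 'a \<times> 'a \<Rightarrow> 'a \<Rightarrow> nat" where
  "edge_tgt = (\<lambda>(\<xi>, x, y). add_particle \<xi> y)"

text \<open>One particle can be carried to any other site while the rest stays put, so all particles can be
gathered at a fixed site \<open>z\<close> one after another.\<close>

lemma constant_if_edge_constant:
  assumes edge: "\<And>\<xi> x y. \<xi> \<in> configs S n \<Longrightarrow> x \<in> S \<Longrightarrow> y \<in> S \<Longrightarrow> 0 < r x y \<Longrightarrow>
      F (add_particle \<xi> x) = F (add_particle \<xi> y)"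
    and "\<eta> \<in> configs S (Suc n)" "\<eta>' \<in> configs S (Suc n)"
  shows "F \<eta> = F \<eta>'"
proof -
  have any: "F (add_particle \<xi> x) = F (add_particle \<xi> y)" if "\<xi> \<in> configs S n" "x \<in> S" "y \<in> S" for \<xi> x y
    using irreducible_walk[OF that(2,3)]
    by (induction rule: rtrancl_induct) (auto dest: edge[OF that(1)])
  obtain z where z: "z \<in> S" using S_nonempty by blast
  define top where "top = (\<lambda>x. if x = z then Suc n else 0)"
  have "F \<eta> = F top" if "\<eta> \<in> configs S (Suc n)" for \<eta>
    using that
  proof (induction "Suc n - \<eta> z" arbitrary: \<eta> rule: less_induct)
    case less
    have total: "(\<Sum>x\<in>S. \<eta> x) = Suc n" "\<And>x. x \<notin> S \<Longrightarrow> \<eta> x = 0" using less.prems by (auto simp: configs_def)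
    have split: "(\<Sum>x\<in>S. \<eta> x) = \<eta> z + (\<Sum>x\<in>S - {z}. \<eta> x)" using z finite_S by (simp add: sum.remove)
    show ?case
    proof (cases "\<exists>x\<in>S - {z}. 0 < \<eta> x")
      case True
      then obtain x where x: "x \<in> S" "x \<noteq> z" "0 < \<eta> x" by blast
      let ?\<xi> = "\<eta>(x := \<eta> x - 1)"
      have \<xi>: "?\<xi> \<in> configs S n" "add_particle ?\<xi> x = \<eta>"
        using add_particle_surj[OF finite_S x(1) less.prems x(3)] by auto
      have "\<eta> z < Suc n"
        using split total x member_le_sum[of x "S - {z}" \<eta>] finite_S by simp
      then have "Suc n - add_particle ?\<xi> z z < Suc n - \<eta> z"
        using x by (simp add: add_particle_def)
      from less.hyps[OF this add_particle_configs[OF finite_S z \<xi>(1)]]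
      have "F (add_particle ?\<xi> z) = F top" .
      with any[OF \<xi>(1) x(1) z] \<xi>(2) show ?thesis by simp
    next
      case False
      then have "(\<Sum>x\<in>S - {z}. \<eta> x) = 0" by simp
      then have "\<eta> z = Suc n" using split total by simp
      then have "\<eta> = top" using False total(2) by (auto simp: top_def fun_eq_iff)
      then show ?thesis by simp
    qed
  qed
  then show ?thesis using assms(2,3) by metis
qed

lemma inclusion_network:
  "finite_network (configs S (Suc n)) (configs S n \<times> S \<times> S) edge_src edge_tgt conductance"
proof
  show "finite (configs S (Suc n))" by (rule finite_configs[OF finite_S])
  show "finite (configs S n \<times> S \<times> S)" using finite_S by (auto intro: finite_configs)
  show "edge_src i \<in> configs S (Suc n)" "edge_tgt i \<in> configs S (Suc n)" "0 \<le> conductance i"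
    if "i \<in> configs S n \<times> S \<times> S" for i
    using that finite_S by (auto simp: edge_src_def edge_tgt_def add_particle_configs conductance_nonneg)
  fix F :: "('a \<Rightarrow> nat) \<Rightarrow> real" and \<eta> \<eta>'
  assume zero: "(\<Sum>i\<in>configs S n \<times> S \<times> S. conductance i * (F (edge_src i) - F (edge_tgt i))\<^sup>2) = 0"
    and \<eta>: "\<eta> \<in> configs S (Suc n)" "\<eta>' \<in> configs S (Suc n)"
  have all: "\<forall>i\<in>configs S n \<times> S \<times> S. conductance i * (F (edge_src i) - F (edge_tgt i))\<^sup>2 = 0"
    using zero finite_S
    by (subst sum_nonneg_eq_0_iff[symmetric]) (auto intro!: finite_configs mult_nonneg_nonneg conductance_nonneg)
  show "F \<eta> = F \<eta>'"
  proof (rule constant_if_edge_constant[OF _ \<eta>])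
    fix \<xi> x y assume *: "\<xi> \<in> configs S n" "x \<in> S" "y \<in> S" "0 < r x y"
    then have "0 < conductance (\<xi>, x, y)"
      unfolding conductance_def using d_pos by (simp add: weight_pos \<alpha>_pos add_pos_nonneg)
    moreover have "conductance (\<xi>, x, y) * (F (add_particle \<xi> x) - F (add_particle \<xi> y))\<^sup>2 = 0"
      using all * by (auto simp: edge_src_def edge_tgt_def)
    ultimately show "F (add_particle \<xi> x) = F (add_particle \<xi> y)" by simp
  qed
qed

sublocale net: finite_network "configs S (Suc n)" "configs S n \<times> S \<times> S" edge_src edge_tgt conductance for n
  by (rule inclusion_network)

text \<open>The inclusion process is the network walk: after removing the jumping particle, the rate times the
weight becomes twice the conductance, and the symmetry between the two sites completes the squares.\<close>

lemma green_identity: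
  "(\<Sum>\<eta>\<in>configs S (Suc n). weight \<eta> * G \<eta> * - inclusion_generator S r d F \<eta>) = net.form n F G"
proof -
  let ?E = "configs S (Suc n)"
  let ?c = "\<lambda>\<xi> x y. conductance (\<xi>, x, y)"
  have pair: "(\<Sum>\<eta>\<in>?E. weight \<eta> * G \<eta> * (real (\<eta> x) * (d + real (\<eta> y)) * r x y * (F \<eta> - F (move \<eta> x y))))
      = (\<Sum>\<xi>\<in>configs S n. 2 * ?c \<xi> x y * (G (add_particle \<xi> x) * (F (add_particle \<xi> x) - F (add_particle \<xi> y))))"
    if xy: "x \<in> S" "y \<in> S" for x y
  proof (cases "x = y")
    case True
    then show ?thesis using rate_diag[OF xy(1)] by (simp add: conductance_def)
  next
    case False
    show ?thesis
    proof (subst sum_configs_add_particle[OF finite_S xy(1)], simp, intro sum.cong refl)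
      fix \<xi> assume "\<xi> \<in> configs S n"
      have 1: "move (add_particle \<xi> x) x y = add_particle \<xi> y"
        using False by (auto simp: move_def add_particle_def fun_eq_iff)
      have 2: "add_particle \<xi> x x = Suc (\<xi> x)" "add_particle \<xi> x y = \<xi> y"
        using False by (auto simp: add_particle_def)
      have e: "weight (add_particle \<xi> x) * real (Suc (\<xi> x)) * (d + real (\<xi> y)) * r x y = 2 * ?c \<xi> x y"
        unfolding weight_add_particle[OF xy(1)] by (simp add: conductance_def)
      show "weight (add_particle \<xi> x) * G (add_particle \<xi> x) *
           (real (add_particle \<xi> x x) * (d + real (add_particle \<xi> x y)) * r x y *
            (F (add_particle \<xi> x) - F (move (add_particle \<xi> x) x y))) =
           2 * ?c \<xi> x y * (G (add_particle \<xi> x) * (F (add_particle \<xi> x) - F (add_particle \<xi> y)))"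
        unfolding 1 2 e[symmetric] by (simp only: mult_ac)
    qed
  qed
  have "(\<Sum>\<eta>\<in>?E. weight \<eta> * G \<eta> * - inclusion_generator S r d F \<eta>)
      = (\<Sum>\<eta>\<in>?E. \<Sum>x\<in>S. \<Sum>y\<in>S. weight \<eta> * G \<eta> * (real (\<eta> x) * (d + real (\<eta> y)) * r x y * (F \<eta> - F (move \<eta> x y))))"
    unfolding inclusion_generator_def sum_negf[symmetric] sum_distrib_left
    by (intro sum.cong refl) (simp add: algebra_simps)
  also have "\<dots> = (\<Sum>x\<in>S. \<Sum>y\<in>S. \<Sum>\<eta>\<in>?E. weight \<eta> * G \<eta> * (real (\<eta> x) * (d + real (\<eta> y)) * r x y * (F \<eta> - F (move \<eta> x y))))"
    by (subst sum.swap, intro sum.cong refl, rule sum.swap)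
  also have "\<dots> = (\<Sum>x\<in>S. \<Sum>y\<in>S. \<Sum>\<xi>\<in>configs S n. 2 * ?c \<xi> x y * (G (add_particle \<xi> x) * (F (add_particle \<xi> x) - F (add_particle \<xi> y))))"
    by (intro sum.cong refl pair)
  finally have A: "(\<Sum>\<eta>\<in>?E. weight \<eta> * G \<eta> * - inclusion_generator S r d F \<eta>) = (\<Sum>x\<in>S. \<Sum>y\<in>S. \<Sum>\<xi>\<in>configs S n. 2 * ?c \<xi> x y * (G (add_particle \<xi> x) * (F (add_particle \<xi> x) - F (add_particle \<xi> y))))" (is "?L = ?R") .
  let ?T = "\<lambda>\<xi> x y. ?c \<xi> x y *
      ((F (add_particle \<xi> x) - F (add_particle \<xi> y)) * (G (add_particle \<xi> x) - G (add_particle \<xi> y)))"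
  have B: "?R = (\<Sum>x\<in>S. \<Sum>y\<in>S. \<Sum>\<xi>\<in>configs S n. 2 * ?c \<xi> x y * (G (add_particle \<xi> y) * (F (add_particle \<xi> y) - F (add_particle \<xi> x))))"
    (is "_ = ?R'")
    by (subst sum.swap) (intro sum.cong refl, simp add: conductance_commute)
  have "?R + ?R' = 2 * (\<Sum>x\<in>S. \<Sum>y\<in>S. \<Sum>\<xi>\<in>configs S n. ?T \<xi> x y)"
    unfolding sum_distrib_left sum.distrib[symmetric]
    by (intro sum.cong refl) (simp add: algebra_simps)
  then have "?L = (\<Sum>x\<in>S. \<Sum>y\<in>S. \<Sum>\<xi>\<in>configs S n. ?T \<xi> x y)"
    using A B by linarith
  also have "\<dots> = (\<Sum>x\<in>S. \<Sum>\<xi>\<in>configs S n. \<Sum>y\<in>S. ?T \<xi> x y)"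
    by (intro sum.cong refl, rule sum.swap)
  also have "\<dots> = (\<Sum>\<xi>\<in>configs S n. \<Sum>x\<in>S. \<Sum>y\<in>S. ?T \<xi> x y)"
    by (rule sum.swap)
  also have "\<dots> = net.form n F G"
    unfolding net.form_def
    by (simp add: edge_src_def edge_tgt_def sum.cartesian_product split_def)
  finally show ?thesis .
qed

end

section \<open>Upper bound on the resistance between two piles\<close>

definition two_piles :: "'a \<Rightarrow> 'a \<Rightarrow> nat \<Rightarrow> nat \<Rightarrow> 'a \<Rightarrow> nat" where
  "two_piles a b j k = (\<lambda>x. if x = a then j else if x = b then k else 0)"

definition pile :: "'a \<Rightarrow> nat \<Rightarrow> 'a \<Rightarrow> nat" where
  "pile a k = (\<lambda>x. if x = a then k else 0)"

lemma two_piles_configs: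
  assumes "finite S" "a \<in> S" "b \<in> S" "a \<noteq> b"
  shows "two_piles a b j k \<in> configs S (j + k)"
proof -
  have "(\<Sum>x\<in>S. two_piles a b j k x) = (\<Sum>x\<in>{a, b}. two_piles a b j k x)"
    using assms by (intro sum.mono_neutral_right) (auto simp: two_piles_def)
  then show ?thesis using assms by (auto simp: configs_def two_piles_def)
qed

lemma pile_configs: "finite S \<Longrightarrow> a \<in> S \<Longrightarrow> pile a N \<in> configs S N"
  by (auto simp: configs_def pile_def)

lemma condensate_eq_pile:
  assumes "finite S" "a \<in> S"
  shows "condensate S N a = {pile a N}"
proof -
  have "\<eta> = pile a N" if "\<eta> \<in> configs S N" "\<eta> a = N" for \<eta>
  proof -
    have "(\<Sum>x\<in>S. \<eta> x) = N" using that by (simp add: configs_def)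
    then have "(\<Sum>x\<in>S - {a}. \<eta> x) = 0" using assms that by (simp add: sum.remove)
    then have "\<eta> x = 0" if "x \<in> S" "x \<noteq> a" for x using that assms by simp
    then show ?thesis using that by (auto simp: pile_def configs_def fun_eq_iff)
  qed
  moreover have "pile a N \<in> configs S N" using assms by (rule pile_configs)
  moreover have "pile a N a = N" by (simp add: pile_def)
  ultimately show ?thesis unfolding condensate_def by blast
qed

context inclusion_setting
begin

lemma weight_two_piles:
  assumes "a \<in> S" "b \<in> S" "a \<noteq> b"
  shows "weight (two_piles a b j k) = \<alpha> a ^ j * inclusion_weight d j * (\<alpha> b ^ k * inclusion_weight d k)"
proof -
  have "weight (two_piles a b j k)
      = (\<Prod>x\<in>{a, b}. \<alpha> x ^ two_piles a b j k x * inclusion_weight d (two_piles a b j k x))"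
    unfolding weight_def using assms finite_S
    by (intro prod.mono_neutral_right) (auto simp: two_piles_def)
  then show ?thesis using assms by (simp add: two_piles_def)
qed

lemma weight_pile:
  assumes "a \<in> S"
  shows "weight (pile a k) = \<alpha> a ^ k * inclusion_weight d k"
proof -
  have "weight (pile a k) = (\<Prod>x\<in>{a}. \<alpha> x ^ pile a k x * inclusion_weight d (pile a k x))"
    unfolding weight_def using assms finite_S
    by (intro prod.mono_neutral_right) (auto simp: pile_def)
  then show ?thesis by (simp add: pile_def)
qed

lemma weight_le_prod_inclusion_weight:
  assumes "\<And>x. x \<in> S \<Longrightarrow> \<alpha> x \<le> 1"
  shows "weight \<eta> \<le> (\<Prod>x\<in>S. inclusion_weight d (\<eta> x))"
  unfolding weight_def
proof (intro prod_mono conjI)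
  fix x assume x: "x \<in> S"
  have w: "0 \<le> inclusion_weight d (\<eta> x)" using inclusion_weight_pos[OF d_pos] by (simp add: less_imp_le)
  show "0 \<le> \<alpha> x ^ \<eta> x * inclusion_weight d (\<eta> x)" using w \<alpha>_pos[OF x] by simp
  show "\<alpha> x ^ \<eta> x * inclusion_weight d (\<eta> x) \<le> inclusion_weight d (\<eta> x)"
    using w \<alpha>_pos[OF x] assms[OF x] by (intro mult_left_le_one_le) (auto intro: power_le_one)
qed

text \<open>Forgetting the factors \<open>\<alpha> \<le> 1\<close> merges all sites into a single one with parameter \<open>card S * d\<close>. The bound
has the order \<open>d / N\<close> of the weight of one pile of \<open>N\<close> particles.\<close>

lemma total_weight_le:
  assumes "\<And>x. x \<in> S \<Longrightarrow> \<alpha> x \<le> 1" and N: "1 \<le> N" and small: "real (card S) * d * (1 + ln (real N)) \<le> 1"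
  shows "(\<Sum>\<eta>\<in>configs S N. weight \<eta>) \<le> 3 * (real (card S) * d) / real N"
proof -
  have "(\<Sum>\<eta>\<in>configs S N. weight \<eta>) \<le> inclusion_weight (real (card S) * d) N"
    unfolding sum_configs_prod_weight[OF finite_S, symmetric]
    using assms(1) by (intro sum_mono weight_le_prod_inclusion_weight)
  also have "\<dots> \<le> 3 * (real (card S) * d) / real N"
  proof (rule inclusion_weight_le[OF _ N order_refl small])
    have "0 < card S" using finite_S S_nonempty by (simp add: card_gt_0_iff)
    then show "0 < real (card S) * d" using d_pos by simp
  qed
  finally show ?thesis .
qed

lemma inclusion_weight_ge_div:
  assumes "d \<le> 1" "k \<le> N" "1 \<le> N"
  shows "d / real N \<le> inclusion_weight d k"
proof (cases "k = 0")
  case True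
  have "d / real N \<le> d / 1" using assms d_pos by (intro divide_left_mono) auto
  then show ?thesis using True assms by simp
next
  case False
  have "d / real N \<le> d / real k" using assms d_pos False by (intro divide_left_mono) auto
  then show ?thesis using inclusion_weight_ge[OF d_pos, of k] False by simp
qed

text \<open>An upper bound on the effective resistance between the two piles. The particles travel one at a time
along the sites \<open>s 0, ..., s L\<close>, which crosses \<open>N * L\<close> edges with \<open>N = n + 1\<close>. Every edge on the way has
conductance at least \<open>K * d ^ 4 / N\<^sup>2\<close>: a factor \<open>d / N\<close> for each of the two piles, and a factor \<open>d\<close> for
each of the two ends of the edge. The Cauchy-Schwarz inequality for the telescoping sum does the rest.\<close>

lemma path_poincare:
  fixes s :: "nat \<Rightarrow> 'a" and F :: "('a \<Rightarrow> nat) \<Rightarrow> real"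
  assumes ends: "s 0 = a" "s L = b" "a \<noteq> b" and in_S: "\<And>i. i \<le> L \<Longrightarrow> s i \<in> S"
    and inj: "inj_on s {..L}" and \<alpha>: "\<alpha> a = 1" "\<alpha> b = 1" and d1: "d \<le> 1"
    and K: "0 < K" "\<And>i. i < L \<Longrightarrow> K \<le> \<alpha> (s i) * r (s i) (s (Suc i)) / 2"
  shows "(F (pile a (Suc n)) - F (pile b (Suc n)))\<^sup>2 \<le> real (Suc n) ^ 3 * real L / (K * d ^ 4) * net.form n F F"
proof -
  let ?N = "real (Suc n)"
  have abS: "a \<in> S" "b \<in> S" using in_S[of 0] in_S[of L] ends by auto
  define \<xi> where "\<xi> k = two_piles a b (n - k) k" for k
  define e where "e = (\<lambda>(k, i). (\<xi> k, s i, s (Suc i)))"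
  define P where "P = {..n} \<times> {..<L}"
  define \<Delta> where "\<Delta> = (\<lambda>(k, i). F (add_particle (\<xi> k) (s i)) - F (add_particle (\<xi> k) (s (Suc i))))"
  have \<xi>_in: "\<xi> k \<in> configs S n" if "k \<le> n" for k
    using two_piles_configs[OF finite_S abS ends(3), of "n - k" k] that by (simp add: \<xi>_def)
  have link: "add_particle (\<xi> k) b = add_particle (\<xi> (Suc k)) a" if "k < n" for k
    using that ends(3) by (auto simp: \<xi>_def two_piles_def add_particle_def fun_eq_iff)
  have row: "(\<Sum>i<L. \<Delta> (k, i)) = F (add_particle (\<xi> k) a) - F (add_particle (\<xi> k) b)" for k
    using sum_lessThan_telescope'[of "\<lambda>i. F (add_particle (\<xi> k) (s i))" L] ends by (simp add: \<Delta>_def)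
  have "(\<Sum>k\<le>m. F (add_particle (\<xi> k) a) - F (add_particle (\<xi> k) b))
      = F (add_particle (\<xi> 0) a) - F (add_particle (\<xi> m) b)" if "m \<le> n" for m
    using that
  proof (induction m)
    case (Suc m)
    then show ?case using link[of m] by simp
  qed simp
  moreover have "add_particle (\<xi> 0) a = pile a (Suc n)" "add_particle (\<xi> n) b = pile b (Suc n)"
    using ends(3) by (auto simp: \<xi>_def two_piles_def add_particle_def pile_def fun_eq_iff)
  ultimately have total: "F (pile a (Suc n)) - F (pile b (Suc n)) = (\<Sum>p\<in>P. \<Delta> p)"
    unfolding P_def sum.cartesian_product' row by simp
  have c: "K * d ^ 4 / ?N\<^sup>2 \<le> conductance (e p)" if "p \<in> P" for p
  proof -
    obtain k i where p: "p = (k, i)" "k \<le> n" "i < L" using \<open>p \<in> P\<close> by (auto simp: P_def)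
    have "(d / ?N) * (d / ?N) \<le> inclusion_weight d (n - k) * inclusion_weight d k"
      using p d1 d_pos by (intro mult_mono inclusion_weight_ge_div less_imp_le[OF inclusion_weight_pos]) auto
    also have "\<dots> = weight (\<xi> k)" using abS ends(3) \<alpha> by (simp add: \<xi>_def weight_two_piles)
    finally have W: "(d / ?N) * (d / ?N) \<le> weight (\<xi> k)" .
    have dd: "d * d \<le> (d + real (\<xi> k (s i))) * (d + real (\<xi> k (s (Suc i))))"
      using d_pos by (intro mult_mono) auto
    have "((d / ?N) * (d / ?N)) * (d * d) * K
        \<le> weight (\<xi> k) * ((d + real (\<xi> k (s i))) * (d + real (\<xi> k (s (Suc i))))) * (\<alpha> (s i) * r (s i) (s (Suc i)) / 2)"
      using d_pos K p W dd by (intro mult_mono) (auto intro!: mult_nonneg_nonneg less_imp_le[OF weight_pos])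
    then show ?thesis
      by (simp add: p e_def conductance_def power2_eq_square power4_eq_xxxx field_simps)
  qed
  have "(\<Sum>p\<in>P. K * d ^ 4 / ?N\<^sup>2 * (\<Delta> p)\<^sup>2) \<le> (\<Sum>p\<in>P. conductance (e p) * (F (edge_src (e p)) - F (edge_tgt (e p)))\<^sup>2)"
  proof (intro sum_mono)
    fix p assume "p \<in> P"
    have "F (edge_src (e p)) - F (edge_tgt (e p)) = \<Delta> p"
      by (simp add: e_def \<Delta>_def edge_src_def edge_tgt_def split_def)
    then show "K * d ^ 4 / ?N\<^sup>2 * (\<Delta> p)\<^sup>2 \<le> conductance (e p) * (F (edge_src (e p)) - F (edge_tgt (e p)))\<^sup>2"
      using mult_right_mono[OF c[OF \<open>p \<in> P\<close>] zero_le_power2] by (simp only:)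
  qed
  also have "\<dots> = (\<Sum>i\<in>e ` P. conductance i * (F (edge_src i) - F (edge_tgt i))\<^sup>2)"
  proof (rule sum.reindex_cong[symmetric, OF _ refl refl])
    have "k = k'" if "\<xi> k = \<xi> k'" for k k'
      using fun_cong[OF that, of b] ends(3) by (simp add: \<xi>_def two_piles_def split: if_splits)
    moreover have "i = i'" if "s i = s i'" "i < L" "i' < L" for i i'
      using inj_onD[OF inj that(1)] that by simp
    ultimately show "inj_on e P" by (auto simp: inj_on_def e_def P_def)
  qed
  also have "\<dots> \<le> net.form n F F"
    unfolding net.form_self
  proof (rule sum_mono2)
    show "e ` P \<subseteq> configs S n \<times> S \<times> S" using \<xi>_in in_S by (auto simp: e_def P_def)
    show "finite (configs S n \<times> S \<times> S)" using finite_S finite_configs by auto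
  qed (auto intro!: mult_nonneg_nonneg conductance_nonneg)
  finally have energy: "K * d ^ 4 / ?N\<^sup>2 * (\<Sum>p\<in>P. (\<Delta> p)\<^sup>2) \<le> net.form n F F"
    by (simp add: sum_distrib_left)
  have "(\<Sum>p\<in>P. \<Delta> p)\<^sup>2 \<le> (\<Sum>p\<in>P. (\<Delta> p)\<^sup>2) * real (card P)"
    using Cauchy_Schwarz_ineq_sum[of \<Delta> "\<lambda>_. 1" P] by simp
  also have "real (card P) = ?N * real L" by (simp add: P_def algebra_simps)
  finally have cs: "(\<Sum>p\<in>P. \<Delta> p)\<^sup>2 \<le> (\<Sum>p\<in>P. (\<Delta> p)\<^sup>2) * (?N * real L)" .
  have "(\<Sum>p\<in>P. (\<Delta> p)\<^sup>2) \<le> ?N\<^sup>2 / (K * d ^ 4) * net.form n F F"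
  proof -
    have pos: "0 < K * d ^ 4" "0 < ?N\<^sup>2" using K d_pos by auto
    have "K * d ^ 4 * (\<Sum>p\<in>P. (\<Delta> p)\<^sup>2) \<le> ?N\<^sup>2 * net.form n F F"
      using energy pos(2) by (simp add: field_simps del: of_nat_Suc)
    then show ?thesis using pos(1) by (simp add: pos_le_divide_eq mult.commute del: of_nat_Suc)
  qed
  then have "(\<Sum>p\<in>P. (\<Delta> p)\<^sup>2) * (?N * real L) \<le> ?N\<^sup>2 / (K * d ^ 4) * net.form n F F * (?N * real L)"
    by (rule mult_right_mono) simp
  with cs have "(\<Sum>p\<in>P. \<Delta> p)\<^sup>2 \<le> ?N\<^sup>2 / (K * d ^ 4) * net.form n F F * (?N * real L)"
    by (rule order_trans)
  then show ?thesis
    unfolding total by (simp add: power2_eq_square power3_eq_cube mult_ac del: of_nat_Suc)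
qed

end

section \<open>Energy of a test function that cuts an interior edge\<close>

text \<open>The weight of \<open>a\<close> particles spread over a site with geometric penalty \<open>\<rho>\<close>, which is an end of the edge
being crossed and so carries the factor \<open>d + j\<close>, and over \<open>c\<close> further sites without penalty.\<close>

definition biased_weight_sum :: "real \<Rightarrow> real \<Rightarrow> real \<Rightarrow> nat \<Rightarrow> real" where
  "biased_weight_sum \<rho> d c a
    = (\<Sum>j\<le>a. inclusion_weight d j * \<rho> ^ j * (d + real j) * inclusion_weight (c * d) (a - j))"

lemma inclusion_weight_mult_le:
  assumes d: "0 < d" "d \<le> 1" and j: "j \<le> N" and small: "d * (1 + ln (real N)) \<le> 1"
  shows "inclusion_weight d j * (d + real j) \<le> 6 * d"
proof (cases "j = 0")
  case True
  then show ?thesis using d by simp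
next
  case False
  have "inclusion_weight d j * (d + real j) \<le> (3 * d / real j) * (2 * real j)"
    using False d j small less_imp_le[OF inclusion_weight_pos[OF d(1), of j]]
    by (intro mult_mono inclusion_weight_le) auto
  then show ?thesis using False by simp
qed

lemma biased_weight_sum_nonneg:
  assumes "0 < d" "0 < c" "0 \<le> \<rho>"
  shows "0 \<le> biased_weight_sum \<rho> d c a"
  unfolding biased_weight_sum_def using assms
  by (intro sum_nonneg mult_nonneg_nonneg less_imp_le[OF inclusion_weight_pos]) auto

text \<open>One factor \<open>d\<close> comes from the penalised site, where \<open>inclusion_weight d j * (d + j)\<close> is of order \<open>d\<close> for
every \<open>j\<close>, and another one from the \<open>a - j\<close> particles elsewhere. The geometric penalty keeps \<open>j\<close> bounded.
Only the term \<open>j = a\<close>, with nobody elsewhere, lacks the second factor; for it the hypothesis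
\<open>tail\<close> is needed, which is where the subexponential decay of \<open>d\<close> enters.\<close>

lemma biased_weight_sum_le:
  assumes d: "0 < d" "d \<le> 1" and c: "1 \<le> c" and \<rho>: "0 < \<rho>" "\<rho> < 1" and a: "1 \<le> a" "a \<le> N"
    and small: "c * d * (1 + ln (real N)) \<le> 1" and tail: "\<rho> ^ a \<le> d / real a"
  shows "biased_weight_sum \<rho> d c a \<le> (18 * c / (1 - \<rho>)\<^sup>2 + 6) * d\<^sup>2 / real a"
proof -
  have cd: "0 < c * d" using c d by simp
  have small1: "d * (1 + ln (real N)) \<le> 1"
  proof -
    have "1 * (d * (1 + ln (real N))) \<le> c * (d * (1 + ln (real N)))"
      using a c d by (intro mult_right_mono) auto
    then show ?thesis using small by (simp add: mult.assoc)
  qed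
  have first: "inclusion_weight d j * \<rho> ^ j * (d + real j) * inclusion_weight (c * d) (a - j)
      \<le> (18 * c * d\<^sup>2 / real a) * (real (Suc j) * \<rho> ^ j)" if j: "j < a" for j
  proof -
    \<comment> \<open>Trading the singularity of \<open>1 / (a - j)\<close> for a polynomial factor that the geometric weight absorbs.\<close>
    have "real a \<le> real (Suc j) * real (a - j)"
    proof -
      have "0 \<le> real j * (real a - real j - 1)" using j by (intro mult_nonneg_nonneg) auto
      then show ?thesis using j by (simp add: of_nat_diff algebra_simps)
    qed
    then have "1 / real (a - j) \<le> real (Suc j) / real a"
      using j by (simp add: field_simps)
    then have "(3 * (c * d)) * (1 / real (a - j)) \<le> (3 * (c * d)) * (real (Suc j) / real a)"
      using cd by (intro mult_left_mono) auto
    moreover have "inclusion_weight (c * d) (a - j) \<le> 3 * (c * d) / real (a - j)"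
      using j a by (intro inclusion_weight_le[OF cd _ _ small]) auto
    ultimately have w: "inclusion_weight (c * d) (a - j) \<le> 3 * (c * d) * (real (Suc j) / real a)" by simp
    have "(inclusion_weight d j * (d + real j)) * inclusion_weight (c * d) (a - j)
        \<le> (6 * d) * (3 * (c * d) * (real (Suc j) / real a))"
      using j a d cd less_imp_le[OF inclusion_weight_pos[OF cd]]
      by (intro mult_mono[OF inclusion_weight_mult_le[OF d _ small1] w]) auto
    then have "(inclusion_weight d j * (d + real j)) * inclusion_weight (c * d) (a - j) * \<rho> ^ j
        \<le> (6 * d) * (3 * (c * d) * (real (Suc j) / real a)) * \<rho> ^ j"
      using \<rho> by (intro mult_right_mono) auto
    then show ?thesis by (simp only: power2_eq_square) (simp add: mult_ac del: of_nat_Suc)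
  qed
  have geometric: "(\<Sum>j<a. real (Suc j) * \<rho> ^ j) \<le> 1 / (1 - \<rho>)\<^sup>2"
  proof -
    have sums: "(\<lambda>j. real (Suc j) * \<rho> ^ j) sums (1 / (1 - \<rho>)\<^sup>2)"
      using geometric_deriv_sums[of \<rho>] \<rho> by simp
    show ?thesis using sum_le_suminf[OF sums_summable[OF sums], of "{..<a}"] \<rho> sums_unique[OF sums] by simp
  qed
  have "biased_weight_sum \<rho> d c a
      = (\<Sum>j<a. inclusion_weight d j * \<rho> ^ j * (d + real j) * inclusion_weight (c * d) (a - j))
        + \<rho> ^ a * (inclusion_weight d a * (d + real a))"
    unfolding biased_weight_sum_def by (simp add: lessThan_Suc_atMost[symmetric] mult_ac)
  also have "\<dots> \<le> (\<Sum>j<a. (18 * c * d\<^sup>2 / real a) * (real (Suc j) * \<rho> ^ j)) + (d / real a) * (6 * d)"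
    using a d \<rho> less_imp_le[OF inclusion_weight_pos[OF d(1)]]
    by (intro add_mono sum_mono first mult_mono[OF tail inclusion_weight_mult_le[OF d _ small1]]) auto
  also have "(\<Sum>j<a. (18 * c * d\<^sup>2 / real a) * (real (Suc j) * \<rho> ^ j))
      \<le> (18 * c * d\<^sup>2 / real a) * (1 / (1 - \<rho>)\<^sup>2)"
    unfolding sum_distrib_left[symmetric] using c by (intro mult_left_mono geometric) auto
  finally show ?thesis by (simp add: add_divide_distrib algebra_simps power2_eq_square)
qed

text \<open>Flat on the outer quarters of \<open>[0, N]\<close>. A linear profile on the whole interval would have energy of
order \<open>d ^ 3 / N ^ 3\<close>, because of the configurations with nearly all particles in one pile.\<close>

definition ramp :: "real \<Rightarrow> nat \<Rightarrow> real" where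
  "ramp N k = max 0 (min 1 (2 * real k / N - 1 / 2))"

lemma ramp_step_sq_le: "0 < N \<Longrightarrow> (ramp N (Suc k) - ramp N k)\<^sup>2 \<le> 4 / N\<^sup>2"
proof -
  assume N: "0 < N"
  have step: "2 * real (Suc k) / N - 1 / 2 = (2 * real k / N - 1 / 2) + 2 / N"
    using N by (simp add: field_simps)
  have lipschitz: "\<bar>max 0 (min 1 (x + e)) - max 0 (min 1 x)\<bar> \<le> e" if "0 \<le> e" for x e :: real
    using that by (auto simp: max_def min_def)
  have "\<bar>ramp N (Suc k) - ramp N k\<bar> \<le> 2 / N"
    unfolding ramp_def step by (rule lipschitz) (use N in simp)
  then have "\<bar>ramp N (Suc k) - ramp N k\<bar>\<^sup>2 \<le> (2 / N)\<^sup>2" by (rule power_mono) simp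
  then show ?thesis by (simp add: power_divide)
qed

lemma ramp_step_nonzero:
  assumes "0 < N" "ramp N (Suc k) \<noteq> ramp N k"
  shows "N / 4 < real k + 1" "real k < 3 * N / 4"
proof -
  have step: "2 * real k / N \<le> 2 * real (Suc k) / N" using assms(1) by (simp add: divide_right_mono)
  have "\<not> 2 * real (Suc k) / N \<le> 1 / 2"
  proof
    assume le: "2 * real (Suc k) / N \<le> 1 / 2"
    have "ramp N (Suc k) = 0" "ramp N k = 0" unfolding ramp_def using le step by linarith+
    then show False using assms(2) by simp
  qed
  then show "N / 4 < real k + 1" using assms(1) by (simp add: field_simps)
  have "\<not> 3 / 2 \<le> 2 * real k / N"
  proof
    assume le: "3 / 2 \<le> 2 * real k / N"
    have "ramp N (Suc k) = 1" "ramp N k = 1" unfolding ramp_def using le step by linarith+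
    then show False using assms(2) by simp
  qed
  then show "real k < 3 * N / 4" using assms(1) by (simp add: field_simps)
qed

text \<open>The sites \<open>p1, p2\<close> are connected to the other sites only through the edge between \<open>p2\<close> and \<open>p3\<close>, and
both ends of this edge have \<open>\<alpha> < 1\<close>, so that neither of them can hold the condensate.\<close>

locale inclusion_bottleneck = inclusion_setting +
  fixes p1 p2 p3 :: 'a and R :: "'a set" and \<rho> :: real
  assumes S_eq: "S = insert p2 (insert p1 (insert p3 R))"
    and distinct: "p1 \<noteq> p2" "p1 \<noteq> p3" "p2 \<noteq> p3" "p1 \<notin> R" "p2 \<notin> R" "p3 \<notin> R"
    and R_nonempty: "R \<noteq> {}"
    and only_bridge: "x \<in> {p1, p2} \<Longrightarrow> y \<in> insert p3 R \<Longrightarrow> (x, y) \<noteq> (p2, p3) \<Longrightarrow> r x y = 0"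
    and \<alpha>_le_1: "x \<in> S \<Longrightarrow> \<alpha> x \<le> 1"
    and \<rho>: "\<alpha> p2 \<le> \<rho>" "\<alpha> p3 \<le> \<rho>" "\<rho> < 1"
begin

lemma \<rho>_pos: "0 < \<rho>"
  using \<rho>(1) \<alpha>_pos[of p2] S_eq by auto

lemma finite_R: "finite R"
  using finite_S S_eq by simp

lemma weight_le_split:
  "weight \<xi> \<le> inclusion_weight d (\<xi> p1) * (inclusion_weight d (\<xi> p2) * \<rho> ^ \<xi> p2)
     * (inclusion_weight d (\<xi> p3) * \<rho> ^ \<xi> p3) * (\<Prod>x\<in>R. inclusion_weight d (\<xi> x))"
proof -
  have w: "0 \<le> inclusion_weight d k" for k using inclusion_weight_pos[OF d_pos] by (simp add: less_imp_le)
  have in_S: "p1 \<in> S" "p2 \<in> S" "p3 \<in> S" and RS: "x \<in> R \<Longrightarrow> x \<in> S" for x using S_eq by auto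
  define g where "g x = (if x = p2 \<or> x = p3 then \<rho> else 1)" for x
  have "weight \<xi> \<le> (\<Prod>x\<in>S. g x ^ \<xi> x * inclusion_weight d (\<xi> x))"
    unfolding weight_def
  proof (intro prod_mono conjI mult_right_mono power_mono)
    fix x assume "x \<in> S"
    then show "0 \<le> \<alpha> x ^ \<xi> x * inclusion_weight d (\<xi> x)" "0 \<le> \<alpha> x"
      using \<alpha>_pos[of x] w by (auto simp: less_imp_le)
    show "\<alpha> x \<le> g x" using \<rho> \<alpha>_le_1[OF \<open>x \<in> S\<close>] by (auto simp: g_def)
  qed (rule w)
  also have "\<dots> = (g p2 ^ \<xi> p2 * inclusion_weight d (\<xi> p2)) * ((g p1 ^ \<xi> p1 * inclusion_weight d (\<xi> p1)) *
      ((g p3 ^ \<xi> p3 * inclusion_weight d (\<xi> p3)) * (\<Prod>x\<in>R. g x ^ \<xi> x * inclusion_weight d (\<xi> x))))"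
    unfolding S_eq using distinct finite_R by simp
  also have "(\<Prod>x\<in>R. g x ^ \<xi> x * inclusion_weight d (\<xi> x)) = (\<Prod>x\<in>R. inclusion_weight d (\<xi> x))"
    using distinct by (intro prod.cong) (auto simp: g_def)
  finally show ?thesis using distinct by (simp add: g_def mult_ac)
qed

abbreviation left_count :: "('a \<Rightarrow> nat) \<Rightarrow> nat" where
  "left_count \<eta> \<equiv> \<eta> p1 + \<eta> p2"

text \<open>The number of particles at \<open>p1\<close> and \<open>p2\<close> changes only when a particle crosses the bridge.\<close>

lemma form_left_count:
  "net.form n (\<lambda>\<eta>. \<phi> (left_count \<eta>)) (\<lambda>\<eta>. \<phi> (left_count \<eta>))
   = (\<Sum>\<xi>\<in>configs S n. 2 * conductance (\<xi>, p2, p3) * (\<phi> (Suc (left_count \<xi>)) - \<phi> (left_count \<xi>))\<^sup>2)"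
proof -
  have in_S: "p2 \<in> S" "p3 \<in> S" using S_eq by auto
  define g where "g \<xi> x y = conductance (\<xi>, x, y) *
     (\<phi> (left_count (add_particle \<xi> x)) - \<phi> (left_count (add_particle \<xi> y)))\<^sup>2" for \<xi> x y
  have lc: "left_count (add_particle \<xi> x) = (if x \<in> {p1, p2} then Suc (left_count \<xi>) else left_count \<xi>)" for \<xi> x
    using distinct by (auto simp: add_particle_def)
  have zero: "g \<xi> x y = 0" if xy: "x \<in> S" "y \<in> S" "(x, y) \<noteq> (p2, p3)" "(x, y) \<noteq> (p3, p2)" for \<xi> x y
  proof -
    consider "x \<in> {p1, p2} \<longleftrightarrow> y \<in> {p1, p2}" | "x \<in> {p1, p2}" "y \<in> insert p3 R" | "y \<in> {p1, p2}" "x \<in> insert p3 R"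
      using xy(1,2) unfolding S_eq by blast
    then show ?thesis
    proof cases
      case 1
      then show ?thesis unfolding g_def lc by simp
    next
      case 2
      then show ?thesis using only_bridge[OF 2] that(3) by (simp add: g_def conductance_def)
    next
      case 3
      then have "r y x = 0" using only_bridge[OF 3] that(4) by blast
      then have "conductance (\<xi>, y, x) = 0" by (simp add: conductance_def)
      then show ?thesis using conductance_commute[OF that(1,2)] by (simp add: g_def)
    qed
  qed
  have "(\<Sum>p\<in>S \<times> S. g \<xi> (fst p) (snd p))
      = 2 * conductance (\<xi>, p2, p3) * (\<phi> (Suc (left_count \<xi>)) - \<phi> (left_count \<xi>))\<^sup>2" for \<xi>
  proof -
    have "(\<Sum>p\<in>S \<times> S. g \<xi> (fst p) (snd p)) = (\<Sum>p\<in>{(p2, p3), (p3, p2)}. g \<xi> (fst p) (snd p))"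
    proof (rule sum.mono_neutral_right)
      show "\<forall>p\<in>S \<times> S - {(p2, p3), (p3, p2)}. g \<xi> (fst p) (snd p) = 0"
      proof
        fix p assume p: "p \<in> S \<times> S - {(p2, p3), (p3, p2)}"
        obtain x y where xy: "p = (x, y)" by (cases p)
        show "g \<xi> (fst p) (snd p) = 0" using p zero[of x y \<xi>] unfolding xy by simp
      qed
    qed (use finite_S in_S in auto)
    also have "\<dots> = g \<xi> p2 p3 + g \<xi> p3 p2" using distinct by simp
    also have "g \<xi> p2 p3 = conductance (\<xi>, p2, p3) * (\<phi> (Suc (left_count \<xi>)) - \<phi> (left_count \<xi>))\<^sup>2"
      unfolding g_def lc using distinct by simp
    also have "g \<xi> p3 p2 = conductance (\<xi>, p2, p3) * (\<phi> (Suc (left_count \<xi>)) - \<phi> (left_count \<xi>))\<^sup>2"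
      unfolding g_def lc conductance_commute[OF in_S(2,1)]
      using distinct by (simp add: power2_commute[of "\<phi> (left_count \<xi>)"])
    finally show ?thesis by simp
  qed
  moreover have "net.form n (\<lambda>\<eta>. \<phi> (left_count \<eta>)) (\<lambda>\<eta>. \<phi> (left_count \<eta>))
      = (\<Sum>\<xi>\<in>configs S n. \<Sum>p\<in>S \<times> S. g \<xi> (fst p) (snd p))"
    unfolding net.form_self sum.cartesian_product'[of _ "configs S n"]
    by (intro sum.cong refl) (simp add: g_def edge_src_def edge_tgt_def split_def)
  ultimately show ?thesis by simp
qed

text \<open>Sort the configurations by the number \<open>a\<close> of particles at \<open>p1\<close> and \<open>p2\<close>: the two sides of the bridge
then decouple.\<close>

lemma sum_configs_split:
  "(\<Sum>\<xi>\<in>configs S n. G (left_count \<xi>) * (A (\<xi> p2) * B (\<xi> p1)) * C (\<xi> p3) * (\<Prod>x\<in>R. inclusion_weight d (\<xi> x)))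
   = (\<Sum>a\<le>n. G a * (\<Sum>j\<le>a. A j * B (a - j)) * (\<Sum>l\<le>n - a. C l * inclusion_weight (real (card R) * d) (n - a - l)))"
proof -
  let ?W = "inclusion_weight (real (card R) * d)"
  define Q where "Q a = (\<Sum>l\<le>n - a. C l * ?W (n - a - l))" for a
  define P where "P \<xi> = (\<Prod>x\<in>R. inclusion_weight d (\<xi> x))" for \<xi> :: "'a \<Rightarrow> nat"
  have sum_P: "(\<Sum>\<zeta>\<in>configs R k. P \<zeta>) = ?W k" for k
    unfolding P_def by (rule sum_configs_prod_weight[OF finite_R])
  have upd: "P (\<xi>(q := k)) = P \<xi>" if "q \<notin> R" for \<xi> q k
    unfolding P_def using that by (intro prod.cong) auto
  have "(\<Sum>\<xi>\<in>configs S n. G (left_count \<xi>) * (A (\<xi> p2) * B (\<xi> p1)) * C (\<xi> p3) * P \<xi>)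
      = (\<Sum>j\<le>n. \<Sum>i\<le>n - j. \<Sum>l\<le>n - j - i. \<Sum>\<zeta>\<in>configs R (n - j - i - l). G (i + j) * (A j * B i) * C l * P \<zeta>)"
    unfolding S_eq using distinct finite_R
    by (simp add: sum_configs_insert upd)
  also have "\<dots> = (\<Sum>j\<le>n. \<Sum>i\<le>n - j. G (i + j) * (A j * B i) * Q (j + i))"
    by (simp add: sum_distrib_left[symmetric] sum_P mult.assoc Q_def)
  also have "\<dots> = (\<Sum>(j, i)\<in>{(j, i). j + i \<le> n}. G (i + j) * (A j * B i) * Q (j + i))"
  proof -
    have "{(j, i). j + i \<le> n} = (SIGMA j:{..n}. {..n - j})" by auto
    then show ?thesis by (simp add: sum.Sigma)
  qed
  also have "\<dots> = (\<Sum>a\<le>n. \<Sum>j\<le>a. G (a - j + j) * (A j * B (a - j)) * Q (j + (a - j)))"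
    by (rule sum.triangle_reindex_eq)
  also have "\<dots> = (\<Sum>a\<le>n. G a * (\<Sum>j\<le>a. A j * B (a - j)) * Q a)"
    by (intro sum.cong refl) (simp add: sum_distrib_left[symmetric] sum_distrib_right[symmetric])
  finally show ?thesis unfolding P_def Q_def .
qed

lemma form_left_count_le:
  "net.form n (\<lambda>\<eta>. \<phi> (left_count \<eta>)) (\<lambda>\<eta>. \<phi> (left_count \<eta>))
   \<le> \<alpha> p2 * r p2 p3 * (\<Sum>a\<le>n. (\<phi> (Suc a) - \<phi> a)\<^sup>2 * biased_weight_sum \<rho> d 1 a
        * biased_weight_sum \<rho> d (real (card R)) (n - a))"
proof -
  let ?\<psi> = "\<lambda>a. (\<phi> (Suc a) - \<phi> a)\<^sup>2"
  let ?A = "\<lambda>j. inclusion_weight d j * \<rho> ^ j * (d + real j)"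
  have k: "0 \<le> \<alpha> p2 * r p2 p3" using \<alpha>_pos[of p2] rate_nonneg[of p2 p3] S_eq by simp
  have "net.form n (\<lambda>\<eta>. \<phi> (left_count \<eta>)) (\<lambda>\<eta>. \<phi> (left_count \<eta>))
      = (\<Sum>\<xi>\<in>configs S n. (\<alpha> p2 * r p2 p3) * (?\<psi> (left_count \<xi>) * (d + real (\<xi> p2)) * (d + real (\<xi> p3)) * weight \<xi>))"
    unfolding form_left_count by (intro sum.cong refl) (simp add: conductance_def)
  also have "\<dots> = (\<alpha> p2 * r p2 p3) * (\<Sum>\<xi>\<in>configs S n. ?\<psi> (left_count \<xi>) * (d + real (\<xi> p2)) * (d + real (\<xi> p3)) * weight \<xi>)"
    by (rule sum_distrib_left[symmetric])
  also have "\<dots> \<le> (\<alpha> p2 * r p2 p3) * (\<Sum>\<xi>\<in>configs S n.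
      ?\<psi> (left_count \<xi>) * (?A (\<xi> p2) * inclusion_weight d (\<xi> p1)) * ?A (\<xi> p3) * (\<Prod>x\<in>R. inclusion_weight d (\<xi> x)))"
  proof (intro mult_left_mono[OF _ k] sum_mono)
    fix \<xi>
    have "?\<psi> (left_count \<xi>) * (d + real (\<xi> p2)) * (d + real (\<xi> p3)) * weight \<xi>
        \<le> ?\<psi> (left_count \<xi>) * (d + real (\<xi> p2)) * (d + real (\<xi> p3)) *
          (inclusion_weight d (\<xi> p1) * (inclusion_weight d (\<xi> p2) * \<rho> ^ \<xi> p2)
           * (inclusion_weight d (\<xi> p3) * \<rho> ^ \<xi> p3) * (\<Prod>x\<in>R. inclusion_weight d (\<xi> x)))"
      using d_pos by (intro mult_left_mono weight_le_split mult_nonneg_nonneg) auto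
    then show "?\<psi> (left_count \<xi>) * (d + real (\<xi> p2)) * (d + real (\<xi> p3)) * weight \<xi>
        \<le> ?\<psi> (left_count \<xi>) * (?A (\<xi> p2) * inclusion_weight d (\<xi> p1)) * ?A (\<xi> p3) * (\<Prod>x\<in>R. inclusion_weight d (\<xi> x))"
      by (simp only: mult_ac)
  qed
  also have "\<dots> = \<alpha> p2 * r p2 p3 * (\<Sum>a\<le>n. ?\<psi> a * biased_weight_sum \<rho> d 1 a * biased_weight_sum \<rho> d (real (card R)) (n - a))"
    using sum_configs_split[where n = n and G = "\<lambda>a. (\<phi> (Suc a) - \<phi> a)\<^sup>2" and A = "\<lambda>j. inclusion_weight d j * \<rho> ^ j * (d + real j)"
        and B = "inclusion_weight d" and C = "\<lambda>j. inclusion_weight d j * \<rho> ^ j * (d + real j)"]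
    by (simp only: biased_weight_sum_def mult_1)
  finally show ?thesis .
qed

text \<open>Where the ramp is not flat, both sides of the bridge hold at least \<open>N / 8\<close> particles, so each side
contributes a factor of order \<open>d\<^sup>2 / N\<close>. With at most \<open>N\<close> values of \<open>a\<close> and squared increments of at most
\<open>4 / N\<^sup>2\<close> the total is of order \<open>d ^ 4 / N ^ 3\<close>.\<close>

lemma ramp_energy_le:
  fixes n :: nat
  defines "N \<equiv> real (Suc n)"
  assumes N: "8 \<le> N" and d1: "d \<le> 1" and small: "real (card R) * d * (1 + ln N) \<le> 1"
    and tail: "\<rho> powr (N / 8) * N \<le> d"
  shows "net.form n (\<lambda>\<eta>. ramp N (left_count \<eta>)) (\<lambda>\<eta>. ramp N (left_count \<eta>))
   \<le> \<alpha> p2 * r p2 p3 * (256 * (18 * real (card R) / (1 - \<rho>)\<^sup>2 + 6)\<^sup>2) * (d ^ 4 / N ^ 3)"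
proof -
  let ?C = "18 * real (card R) / (1 - \<rho>)\<^sup>2 + 6"
  have cR: "1 \<le> real (card R)" using finite_R R_nonempty by (simp add: Suc_le_eq card_gt_0_iff)
  have C: "18 * 1 / (1 - \<rho>)\<^sup>2 + 6 \<le> ?C" "0 \<le> ?C" using cR by (auto intro!: divide_right_mono)
  have small1: "1 * d * (1 + ln N) \<le> 1"
  proof -
    have "1 * (d * (1 + ln N)) \<le> real (card R) * (d * (1 + ln N))"
      using cR d_pos N by (intro mult_right_mono) auto
    then show ?thesis using small by (simp add: mult.assoc)
  qed
  have b: "biased_weight_sum \<rho> d c a \<le> ?C * d\<^sup>2 * (8 / N)"
    if a: "N / 8 \<le> real a" "real a \<le> N" and c: "c = 1 \<or> c = real (card R)" for a c
  proof -
    have a1: "1 \<le> a" using a N by linarith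
    have "\<rho> ^ a = \<rho> powr real a" using \<rho>_pos by (simp add: powr_realpow)
    also have "\<dots> \<le> \<rho> powr (N / 8)" using \<rho>_pos \<rho>(3) a by (intro powr_mono') auto
    also have "\<dots> \<le> d / N" using tail N by (simp add: pos_le_divide_eq)
    also have "\<dots> \<le> d / real a" using a a1 d_pos by (intro divide_left_mono) auto
    finally have t: "\<rho> ^ a \<le> d / real a" .
    have "biased_weight_sum \<rho> d c a \<le> (18 * c / (1 - \<rho>)\<^sup>2 + 6) * d\<^sup>2 / real a"
      using c cR small small1 a a1 d1 d_pos \<rho>_pos \<rho>(3) t
      by (intro biased_weight_sum_le[where N = "Suc n"]) (auto simp: N_def)
    also have "\<dots> \<le> ?C * d\<^sup>2 / real a"
      using c C by (intro divide_right_mono mult_right_mono) auto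
    also have "\<dots> = ?C * d\<^sup>2 * (1 / real a)" by simp
    also have "\<dots> \<le> ?C * d\<^sup>2 * (8 / N)"
      using a a1 N C(2) by (intro mult_left_mono) (auto simp: field_simps)
    finally show ?thesis .
  qed
  have each: "(ramp N (Suc a) - ramp N a)\<^sup>2 * biased_weight_sum \<rho> d 1 a * biased_weight_sum \<rho> d (real (card R)) (n - a)
      \<le> (4 / N\<^sup>2) * (?C * d\<^sup>2 * (8 / N)) * (?C * d\<^sup>2 * (8 / N))" if a: "a \<le> n" for a
  proof (cases "ramp N (Suc a) = ramp N a")
    case True
    have "0 \<le> (4 / N\<^sup>2) * (?C * d\<^sup>2 * (8 / N)) * (?C * d\<^sup>2 * (8 / N))"
      using C(2) N by (intro mult_nonneg_nonneg) auto
    then show ?thesis using True by simp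
  next
    case False
    have r: "N / 4 < real a + 1" "real a < 3 * N / 4" using ramp_step_nonzero[of N a] N False by auto
    have na: "real (n - a) = N - 1 - real a" using a by (simp add: N_def of_nat_diff)
    have "N / 8 \<le> real a" "real a \<le> N" "N / 8 \<le> real (n - a)" "real (n - a) \<le> N"
      using r N unfolding na by linarith+
    then show ?thesis
      using N C(2) cR d_pos \<rho>_pos
      by (intro mult_mono ramp_step_sq_le b mult_nonneg_nonneg biased_weight_sum_nonneg) auto
  qed
  have k: "0 \<le> \<alpha> p2 * r p2 p3" using \<alpha>_pos[of p2] rate_nonneg[of p2 p3] S_eq by simp
  have "net.form n (\<lambda>\<eta>. ramp N (left_count \<eta>)) (\<lambda>\<eta>. ramp N (left_count \<eta>))
      \<le> \<alpha> p2 * r p2 p3 * (\<Sum>a\<le>n. (ramp N (Suc a) - ramp N a)\<^sup>2 * biased_weight_sum \<rho> d 1 a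
          * biased_weight_sum \<rho> d (real (card R)) (n - a))"
    by (rule form_left_count_le)
  also have "\<dots> \<le> \<alpha> p2 * r p2 p3 * (\<Sum>a\<le>n. (4 / N\<^sup>2) * (?C * d\<^sup>2 * (8 / N)) * (?C * d\<^sup>2 * (8 / N)))"
    by (intro mult_left_mono[OF _ k] sum_mono each) simp
  also have "(\<Sum>a\<le>n. (4 / N\<^sup>2) * (?C * d\<^sup>2 * (8 / N)) * (?C * d\<^sup>2 * (8 / N)))
      = N * ((4 / N\<^sup>2) * (?C * d\<^sup>2 * (8 / N)) * (?C * d\<^sup>2 * (8 / N)))"
    by (simp add: N_def)
  also have "\<dots> = 256 * ?C\<^sup>2 * (d ^ 4 / N ^ 3)"
  proof -
    have "N * ((4 / N\<^sup>2) * (c * d\<^sup>2 * (8 / N)) * (c * d\<^sup>2 * (8 / N))) = 256 * c\<^sup>2 * (d ^ 4 / N ^ 3)" for c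
      using N by (simp add: field_simps power2_eq_square power3_eq_cube power4_eq_xxxx)
    then show ?thesis .
  qed
  finally show ?thesis by (simp only: mult.assoc)
qed

end

section \<open>Bounds on the expected crossing time\<close>

context inclusion_setting
begin

text \<open>The weak solution \<open>h\<close> with source \<open>weight\<close> satisfies the strong equation, as is seen by testing with
indicators of single configurations; hence it is the expected hitting time.\<close>

lemma expected_hitting_time_bounds:
  fixes M :: "'w measure" and \<eta> :: "real \<Rightarrow> 'w \<Rightarrow> 'a \<Rightarrow> nat"
  assumes a: "a \<in> S" and b: "b \<in> S" and process: "inclusion_process_from S r d (Suc n) a M \<eta>"
  obtains v where "0 \<le> v"
    and "(\<integral>\<^sup>+ w. hitting_time \<eta> (condensate S (Suc n) b) w \<partial>M) = ennreal v"
    and "\<forall>R\<ge>0. (\<forall>F. (F (pile a (Suc n)) - F (pile b (Suc n)))\<^sup>2 \<le> R * net.form n F F) \<longrightarrow>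
      v \<le> (\<Sum>\<eta>\<in>configs S (Suc n). weight \<eta>) * R"
    and "\<forall>F. \<bar>F (pile a (Suc n)) - F (pile b (Suc n))\<bar> = 1 \<longrightarrow> weight (pile a (Suc n)) \<le> v * net.form n F F"
proof -
  let ?E = "configs S (Suc n)" and ?A = "pile a (Suc n)" and ?B = "pile b (Suc n)"
  have A: "?A \<in> ?E" and B: "?B \<in> ?E" using a b finite_S by (auto intro: pile_configs)
  obtain h where hB: "h ?B = 0" and h: "\<And>G. G ?B = 0 \<Longrightarrow> net.form n h G = (\<Sum>\<eta>\<in>?E. weight \<eta> * G \<eta>)"
    using net.weak_solution_exists[OF B, of weight] by blast
  have W: "\<And>\<eta>. \<eta> \<in> ?E \<Longrightarrow> 0 \<le> weight \<eta>" using weight_pos by (simp add: less_imp_le)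
  have h_nonneg: "0 \<le> h \<eta>" if "\<eta> \<in> ?E" for \<eta>
    by (rule net.weak_supersolution_nonneg[OF W B hB h that])
  have Lh: "inclusion_generator S r d h \<eta> = - 1" if "\<eta> \<in> ?E - {?B}" for \<eta>
  proof -
    let ?G = "\<lambda>\<zeta>. if \<zeta> = \<eta> then 1 else (0::real)"
    have "(\<Sum>\<zeta>\<in>?E. weight \<zeta> * ?G \<zeta> * - inclusion_generator S r d h \<zeta>) = (\<Sum>\<zeta>\<in>?E. weight \<zeta> * ?G \<zeta>)"
      unfolding green_identity using that by (intro h) auto
    moreover have "(\<Sum>\<zeta>\<in>?E. weight \<zeta> * ?G \<zeta> * k \<zeta>) = weight \<eta> * k \<eta>" for k :: "('a \<Rightarrow> nat) \<Rightarrow> real"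
      using that finite_configs[OF finite_S, of "Suc n"] by (simp add: mult_delta_left mult_delta_right)
    from this[of "\<lambda>\<zeta>. - inclusion_generator S r d h \<zeta>"] this[of "\<lambda>_. 1"]
    have "(\<Sum>\<zeta>\<in>?E. weight \<zeta> * ?G \<zeta> * - inclusion_generator S r d h \<zeta>) = weight \<eta> * - inclusion_generator S r d h \<eta>"
      "(\<Sum>\<zeta>\<in>?E. weight \<zeta> * ?G \<zeta>) = weight \<eta>"
      by (simp_all only: mult_1_right)
    ultimately have "weight \<eta> * - inclusion_generator S r d h \<eta> = weight \<eta>" by (simp only:)
    then have "weight \<eta> * (inclusion_generator S r d h \<eta> + 1) = 0" by (simp add: algebra_simps)
    then show ?thesis using weight_pos[of \<eta>] by (simp add: eq_neg_iff_add_eq_0)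
  qed
  have "(\<integral>\<^sup>+ w. hitting_time \<eta> {?B} w \<partial>M) = ennreal (h ?A)"
  proof (rule markov_process_expected_hitting_time[where L = "inclusion_generator S r d" and h = h, OF _ _ A _ h_nonneg _ Lh])
    show "markov_process ?E (inclusion_generator S r d) M \<eta>" 
      using process by (simp only: inclusion_process_from_def)
    show "AE w in M. \<eta> 0 w = ?A"
      using process by (simp only: inclusion_process_from_def condensate_eq_pile[OF finite_S a] singleton_iff)
    show "{?B} \<subseteq> ?E" using B by simp
    show "h x = 0" if "x \<in> {?B}" for x using that hB by simp
  qed
  then have "(\<integral>\<^sup>+ w. hitting_time \<eta> (condensate S (Suc n) b) w \<partial>M) = ennreal (h ?A)"
    unfolding condensate_eq_pile[OF finite_S b] .
  moreover have "h ?A \<le> (\<Sum>\<eta>\<in>?E. weight \<eta>) * R"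
    if "0 \<le> R" "\<forall>F. (F ?A - F ?B)\<^sup>2 \<le> R * net.form n F F" for R
    by (rule net.hitting_potential_le[OF W A B hB h that(1)]) (use that(2) in blast)+
  moreover have "weight ?A \<le> h ?A * net.form n F F" if "\<bar>F ?A - F ?B\<bar> = 1" for F
    by (rule net.hitting_potential_ge[OF W A B hB h that])
  ultimately show thesis using that[of "h ?A"] h_nonneg[OF A] by blast
qed

end

context inclusion_bottleneck
begin

definition ramp_energy_constant :: real where
  "ramp_energy_constant = \<alpha> p2 * r p2 p3 * (256 * (18 * real (card R) / (1 - \<rho>)\<^sup>2 + 6)\<^sup>2)"

text \<open>The two capacity estimates match: total weight \<open>d / N\<close> times resistance \<open>N ^ 3 / d ^ 4\<close> from above, and
starting weight \<open>d / N\<close> divided by energy \<open>d ^ 4 / N ^ 3\<close> from below, both of order \<open>N\<^sup>2 / d ^ 3\<close>. The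
test function depends on the two ends only through their roles at the bridge, so both directions of
travel are covered.\<close>

lemma expected_crossing_time_bounds:
  fixes M :: "'w measure" and \<eta> :: "real \<Rightarrow> 'w \<Rightarrow> 'a \<Rightarrow> nat" and s :: "nat \<Rightarrow> 'a" and n :: nat
  defines "N \<equiv> real (Suc n)"
  assumes process: "inclusion_process_from S r d (Suc n) a M \<eta>"
    and ends: "a = p1 \<and> b \<in> R \<or> a \<in> R \<and> b = p1"
    and path: "s 0 = a" "s L = b" "\<And>i. i \<le> L \<Longrightarrow> s i \<in> S" "inj_on s {..L}"
    and \<alpha>: "\<alpha> a = 1" "\<alpha> b = 1"
    and K: "0 < K" "\<And>i. i < L \<Longrightarrow> K \<le> \<alpha> (s i) * r (s i) (s (Suc i)) / 2"
    and N: "8 \<le> N" and small: "real (card S) * d * (1 + ln N) \<le> 1"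
    and tail: "\<rho> powr (N / 8) * N \<le> d" and bridge: "0 < r p2 p3"
  shows "\<exists>v. (\<integral>\<^sup>+ w. hitting_time \<eta> (condensate S (Suc n) b) w \<partial>M) = ennreal v
    \<and> 1 / ramp_energy_constant \<le> d ^ 3 / N\<^sup>2 * v \<and> d ^ 3 / N\<^sup>2 * v \<le> 3 * real (card S) * real L / K"
proof -
  have abS: "a \<in> S" "b \<in> S" and ab: "a \<noteq> b" using ends S_eq distinct by auto
  have cS: "1 \<le> real (card S)" using finite_S S_nonempty by (simp add: Suc_le_eq card_gt_0_iff)
  have cRS: "real (card R) \<le> real (card S)" using finite_S S_eq by (auto intro!: card_mono)
  have lnN: "1 \<le> 1 + ln N" using N by simp
  have d1: "d \<le> 1"
  proof -
    have "1 * d * 1 \<le> real (card S) * d * (1 + ln N)"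
      using cS d_pos lnN by (intro mult_mono) auto
    then show ?thesis using small by simp
  qed
  have smallR: "real (card R) * d * (1 + ln N) \<le> 1"
  proof -
    have "real (card R) * d * (1 + ln N) \<le> real (card S) * d * (1 + ln N)"
      using cRS d_pos lnN by (intro mult_right_mono) auto
    then show ?thesis using small by linarith
  qed
  have Npos: "0 < N" using N by simp
  obtain v where v: "0 \<le> v" "(\<integral>\<^sup>+ w. hitting_time \<eta> (condensate S (Suc n) b) w \<partial>M) = ennreal v"
    and v_le: "\<forall>R\<ge>0. (\<forall>F. (F (pile a (Suc n)) - F (pile b (Suc n)))\<^sup>2 \<le> R * net.form n F F) \<longrightarrow>
      v \<le> (\<Sum>\<eta>\<in>configs S (Suc n). weight \<eta>) * R"
    and v_ge: "\<forall>F. \<bar>F (pile a (Suc n)) - F (pile b (Suc n))\<bar> = 1 \<longrightarrow> weight (pile a (Suc n)) \<le> v * net.form n F F"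
    by (rule expected_hitting_time_bounds[OF abS process])
  have "v \<le> (\<Sum>\<eta>\<in>configs S (Suc n). weight \<eta>) * (N ^ 3 * real L / (K * d ^ 4))"
  proof (rule v_le[rule_format])
    show "0 \<le> N ^ 3 * real L / (K * d ^ 4)" using Npos K(1) d_pos by simp
    fix F :: "('a \<Rightarrow> nat) \<Rightarrow> real"
    show "(F (pile a (Suc n)) - F (pile b (Suc n)))\<^sup>2 \<le> N ^ 3 * real L / (K * d ^ 4) * net.form n F F"
      unfolding N_def by (rule path_poincare[OF path(1,2) ab path(3,4) \<alpha> d1 K])
  qed
  also have "\<dots> \<le> (3 * (real (card S) * d) / N) * (N ^ 3 * real L / (K * d ^ 4))"
    unfolding N_def using K(1) d_pos small \<alpha>_le_1
    by (intro mult_right_mono total_weight_le) (auto simp: N_def)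
  finally have "d ^ 3 / N\<^sup>2 * v \<le> d ^ 3 / N\<^sup>2 * ((3 * (real (card S) * d) / N) * (N ^ 3 * real L / (K * d ^ 4)))"
    using d_pos Npos by (intro mult_left_mono) auto
  also have "\<dots> = 3 * real (card S) * real L / K"
    using d_pos Npos K(1) by (simp add: field_simps power2_eq_square power3_eq_cube power4_eq_xxxx)
  finally have upper: "d ^ 3 / N\<^sup>2 * v \<le> 3 * real (card S) * real L / K" .
  let ?F = "\<lambda>\<eta>. ramp N (left_count \<eta>)"
  have "left_count (pile q (Suc n)) = 0" if "q \<in> R" for q
    using distinct that by (auto simp: pile_def)
  moreover have "left_count (pile p1 (Suc n)) = Suc n" using distinct by (simp add: pile_def)
  moreover have "2 * real (Suc n) / N = 2" unfolding N_def by (simp del: of_nat_Suc)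
  then have "ramp N (Suc n) = 1" "ramp N 0 = 0" by (simp_all only: ramp_def)
  ultimately have "\<bar>?F (pile a (Suc n)) - ?F (pile b (Suc n))\<bar> = 1" using ends by auto
  from v_ge[rule_format, OF this] have "weight (pile a (Suc n)) \<le> v * net.form n ?F ?F" .
  also have "\<dots> \<le> v * (ramp_energy_constant * (d ^ 4 / N ^ 3))"
    unfolding ramp_energy_constant_def using ramp_energy_le[of n] N d1 smallR tail v(1)
    by (intro mult_left_mono) (auto simp: N_def)
  finally have "weight (pile a (Suc n)) \<le> v * (ramp_energy_constant * (d ^ 4 / N ^ 3))" .
  moreover have "d / N \<le> weight (pile a (Suc n))"
    unfolding N_def weight_pile[OF abS(1)] \<alpha> using inclusion_weight_ge[OF d_pos, of "Suc n"] by simp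
  ultimately have "d / N \<le> v * (ramp_energy_constant * (d ^ 4 / N ^ 3))" by linarith
  then have "(d / N) * (N ^ 3 / d ^ 4) \<le> v * (ramp_energy_constant * (d ^ 4 / N ^ 3)) * (N ^ 3 / d ^ 4)"
    using d_pos Npos by (intro mult_right_mono) auto
  moreover have "(d / N) * (N ^ 3 / d ^ 4) = N\<^sup>2 / d ^ 3"
    using d_pos Npos by (simp add: field_simps power2_eq_square power3_eq_cube power4_eq_xxxx)
  moreover have "v * (ramp_energy_constant * (d ^ 4 / N ^ 3)) * (N ^ 3 / d ^ 4) = v * ramp_energy_constant"
    using d_pos Npos by simp
  ultimately have "N\<^sup>2 / d ^ 3 \<le> v * ramp_energy_constant" by linarith
  moreover have "0 < ramp_energy_constant"
  proof -
    have "0 < (18 * real (card R) / (1 - \<rho>)\<^sup>2 + 6)" by (intro add_nonneg_pos) auto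
    then have "0 < 256 * (18 * real (card R) / (1 - \<rho>)\<^sup>2 + 6)\<^sup>2" by simp
    moreover have "0 < \<alpha> p2 * r p2 p3" using \<alpha>_pos[of p2] bridge S_eq by simp
    ultimately show ?thesis unfolding ramp_energy_constant_def by (rule mult_pos_pos[rotated])
  qed
  ultimately have "1 / ramp_energy_constant \<le> d ^ 3 / N\<^sup>2 * v"
    using d_pos Npos by (simp add: field_simps)
  with v(2) upper show ?thesis by blast
qed

end

section \<open>Asymptotics\<close>

lemma subexponential_dominates_geometric:
  fixes d :: "nat \<Rightarrow> real"
  assumes d: "\<forall>\<delta>>0. filterlim (\<lambda>N. d N * exp (\<delta> * real N)) at_top sequentially"
    and \<rho>: "0 < \<rho>" "\<rho> < 1"
  shows "\<forall>\<^sub>F N in sequentially. \<rho> powr (real N / 8) * real N \<le> d N"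
proof -
  define \<delta> where "\<delta> = - ln \<rho> / 16"
  have \<delta>: "0 < \<delta>" using \<rho> by (simp add: \<delta>_def)
  have "\<forall>\<^sub>F N in sequentially. 1 \<le> d N * exp (\<delta> * real N)"
    using d[rule_format, OF \<delta>] by (simp add: filterlim_at_top)
  moreover have "\<forall>\<^sub>F N in sequentially. 2 / \<delta>\<^sup>2 \<le> real N"
    using filterlim_real_sequentially by (simp add: filterlim_at_top)
  ultimately show ?thesis
  proof eventually_elim
    case (elim N)
    have "real N * 1 \<le> real N * (\<delta>\<^sup>2 * real N / 2)"
      using elim(2) \<delta> by (intro mult_left_mono) (auto simp: field_simps)
    also have "\<dots> = (\<delta> * real N)\<^sup>2 / 2" by (simp add: power2_eq_square)
    also have "\<dots> \<le> exp (\<delta> * real N)"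
      using exp_lower_Taylor_quadratic[of "\<delta> * real N"] mult_nonneg_nonneg[of \<delta> "real N"] \<delta> by linarith
    finally have "real N \<le> exp (\<delta> * real N)" by simp
    moreover have "\<rho> powr (real N / 8) = exp (- (\<delta> * real N)) * exp (- (\<delta> * real N))"
      using \<rho> by (simp add: powr_def \<delta>_def flip: exp_add)
    ultimately have "\<rho> powr (real N / 8) * real N \<le> exp (- (\<delta> * real N)) * exp (- (\<delta> * real N)) * exp (\<delta> * real N)"
      by (simp add: mult_left_mono)
    also have "\<dots> = exp (- (\<delta> * real N)) * 1" by (simp add: mult.assoc flip: exp_add)
    also have "\<dots> \<le> exp (- (\<delta> * real N)) * (d N * exp (\<delta> * real N))"
      using elim(1) by (intro mult_left_mono) auto
    also have "\<dots> = d N" by (simp add: mult.left_commute flip: exp_add)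
    finally show ?case .
  qed
qed

text \<open>The summand \<open>1\<close> is harmless because \<open>ln N \<ge> 1\<close> from \<open>N = 3\<close> on.\<close>

lemma log_vanishing_eventually_small:
  fixes d :: "nat \<Rightarrow> real"
  assumes "\<forall>N\<ge>1. d N > 0" and lim: "(\<lambda>N. d N * ln (real N)) \<longlonglongrightarrow> 0" and c: "0 < c"
  shows "\<forall>\<^sub>F N in sequentially. c * d N * (1 + ln (real N)) \<le> 1"
proof -
  have "\<forall>\<^sub>F N in sequentially. d N * ln (real N) < 1 / (2 * c)"
    using order_tendstoD(2)[OF lim, of "1 / (2 * c)"] c by simp
  moreover have "\<forall>\<^sub>F N in sequentially. (3::nat) \<le> N" by (rule eventually_ge_at_top)
  ultimately show ?thesis
  proof eventually_elim
    case (elim N)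
    have "exp 1 \<le> real N" using exp_le elim(2) by linarith
    then have "1 \<le> ln (real N)" using elim(2) by (subst ln_ge_iff) auto
    then have "d N * (1 + ln (real N)) \<le> d N * (2 * ln (real N))"
      using assms(1) elim(2) by (intro mult_left_mono) (auto simp: less_imp_le)
    also have "d N * (2 * ln (real N)) \<le> 2 * (1 / (2 * c))" using elim(1) by simp
    finally have "c * (d N * (1 + ln (real N))) \<le> c * (2 * (1 / (2 * c)))"
      using c by (intro mult_left_mono) auto
    then show ?case using c by (simp add: mult.assoc)
  qed
qed

section \<open>The movement of the condensate\<close>

theorem theorem2p6:
  fixes \<kappa> :: nat and r :: "nat \<Rightarrow> nat \<Rightarrow> real" and m :: "nat \<Rightarrow> real" and d :: "nat \<Rightarrow> real"
  assumes "\<kappa> > 3"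
    and "reversible_walk {1..\<kappa>} r m"
    and "\<forall>x\<in>{1..\<kappa>}. \<forall>y\<in>{1..\<kappa>}. r x y \<noteq> 0 \<longleftrightarrow> \<bar>int x - int y\<bar> = 1"
    and "max_sites {1..\<kappa>} m = {1, \<kappa>}"
    and "\<forall>N\<ge>1. d N > 0"
    and "\<forall>\<delta>>0. filterlim (\<lambda>N. d N * exp (\<delta> * real N)) at_top sequentially"
    and "(\<lambda>N. d N * ln (real N)) \<longlonglongrightarrow> 0"
  shows "\<exists>C1 C2 :: real. 0 < C1 \<and> 0 < C2 \<and>
    (\<forall>x\<in>max_sites {1..\<kappa>} m. \<forall>y\<in>max_sites {1..\<kappa>} m. x \<noteq> y \<longrightarrow>
      (\<forall>(M :: nat \<Rightarrow> 'w measure) (\<eta> :: nat \<Rightarrow> real \<Rightarrow> 'w \<Rightarrow> nat \<Rightarrow> nat).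
        (\<forall>N\<ge>1. inclusion_process_from {1..\<kappa>} r (d N) N x (M N) (\<eta> N)) \<longrightarrow>
        (let T = (\<lambda>N. ennreal (d N ^ 3 / real N ^ 2) *
                       (\<integral>\<^sup>+ w. hitting_time (\<eta> N) (condensate {1..\<kappa>} N y) w \<partial>M N))
         in ennreal C1 \<le> liminf T \<and> liminf T \<le> limsup T \<and> limsup T \<le> ennreal C2)))"
proof -
  interpret walk: reversible_walk "{1..\<kappa>}" r m by (rule assms(2))
  let ?S = "{1..\<kappa>}"
  define top where "top = Max (m ` ?S)"
  have top_ge: "m x \<le> top" if "x \<in> ?S" for x using that by (simp add: top_def)
  have inner: "m x < top" if "x \<in> ?S" "x \<noteq> 1" "x \<noteq> \<kappa>" for x
    using assms(4) that top_ge[of x] unfolding max_sites_def top_def[symmetric] by (auto simp: less_le)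
  have m1: "m 1 = top" and mk: "m \<kappa> = top"
    using assms(4) unfolding max_sites_def top_def[symmetric] by auto
  have adjacent: "0 < r x (Suc x)" "0 < r (Suc x) x" if "x \<in> ?S" "Suc x \<in> ?S" for x
    using assms(3) that walk.rate_nonneg[OF that] walk.rate_nonneg[OF that(2,1)] by (force simp: less_le)+
  have far: "r x y = 0" if "x \<in> ?S" "y \<in> ?S" "\<bar>int x - int y\<bar> \<noteq> 1" for x y
    using assms(3) that by blast
  have top_pos: "0 < top"
  proof (rule ccontr)
    assume "\<not> 0 < top"
    then have "(\<Sum>x\<in>?S. m x) \<le> 0" using top_ge by (intro sum_nonpos) (meson order_trans not_less)
    then show False using walk.m_sum by simp
  qed
  have m_pos: "0 < m x" if "1 \<le> x" "x \<le> \<kappa>" for x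
    using that
  proof (induction x rule: nat_induct_at_least)
    case base
    then show ?case using m1 top_pos by simp
  next
    case (Suc x)
    then have x: "x \<in> ?S" "Suc x \<in> ?S" by auto
    have "0 < m x * r x (Suc x)" using Suc adjacent[OF x] by simp
    then have "0 < m (Suc x) * r (Suc x) x" using walk.detailed_balance[OF x] by simp
    then show ?case using adjacent[OF x] by (simp add: zero_less_mult_iff)
  qed
  define \<alpha> where "\<alpha> x = m x / top" for x
  have \<alpha>_pos: "0 < \<alpha> x" and \<alpha>_le: "\<alpha> x \<le> 1" if "x \<in> ?S" for x
    using that m_pos[of x] top_ge[of x] top_pos by (auto simp: \<alpha>_def)
  have balance: "\<alpha> x * r x y = \<alpha> y * r y x" if "x \<in> ?S" "y \<in> ?S" for x y
    using walk.detailed_balance[OF that] by (simp add: \<alpha>_def)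
  define \<rho> where "\<rho> = max (\<alpha> 2) (\<alpha> 3)"
  have S23: "2 \<in> ?S" "3 \<in> ?S" "1 \<in> ?S" using assms(1) by auto
  have \<rho>: "0 < \<rho>" "\<rho> < 1"
    using \<alpha>_pos[OF S23(1)] inner[of 2] inner[of 3] assms(1) top_pos S23 by (auto simp: \<rho>_def \<alpha>_def)
  \<comment> \<open>A uniform lower bound for half the conductances of the walk; by detailed balance it serves both directions.\<close>
  define K where "K = Min ((\<lambda>x. \<alpha> x * r x (Suc x) / 2) ` {1..<\<kappa>})"
  have K_le: "K \<le> \<alpha> x * r x (Suc x) / 2" if "x \<in> {1..<\<kappa>}" for x
    unfolding K_def using that by (intro Min_le) auto
  have K_pos: "0 < K"
    unfolding K_def using assms(1) by (subst Min_gr_iff) (auto intro!: mult_pos_pos \<alpha>_pos adjacent)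
  \<comment> \<open>Since \<open>\<kappa> > 3\<close>, both ends of the edge between \<open>2\<close> and \<open>3\<close> are interior sites.\<close>
  have bottleneck: "inclusion_bottleneck ?S r \<alpha> (d N) 1 2 3 {4..\<kappa>} \<rho>" if "1 \<le> N" for N
  proof
    show "0 < d N" using assms(5) that by simp
    show "?S = insert 2 (insert 1 (insert 3 {4..\<kappa>}))" using assms(1) by auto
    show "r x y = 0" if "x \<in> {1, 2}" "y \<in> insert 3 {4..\<kappa>}" "(x, y) \<noteq> (2, 3)" for x y
      using that assms(1) by (intro far) auto
  qed (use assms(1) \<alpha>_pos \<alpha>_le balance \<rho> walk.rate_nonneg walk.rate_diag walk.irreducible_walk
      in \<open>auto simp: \<rho>_def\<close>)
  define C where "C = \<alpha> 2 * r 2 3 * (256 * (18 * real (card {4..\<kappa>}) / (1 - \<rho>)\<^sup>2 + 6)\<^sup>2)"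
  have bridge: "0 < r 2 3" using adjacent[of 2] assms(1) by (simp add: eval_nat_numeral)
  have C_pos: "0 < C"
  proof -
    have "0 < 18 * real (card {4..\<kappa>}) / (1 - \<rho>)\<^sup>2 + 6" by (intro add_nonneg_pos) auto
    then show ?thesis unfolding C_def using \<alpha>_pos[OF S23(1)] bridge by (intro mult_pos_pos zero_less_power) auto
  qed
  define C' where "C' = 3 * real \<kappa> * real (\<kappa> - 1) / K"
  have C'_pos: "0 < C'" unfolding C'_def using K_pos assms(1) by simp
  have large: "\<forall>\<^sub>F N in sequentially. 8 \<le> N \<and> real \<kappa> * d N * (1 + ln (real N)) \<le> 1
      \<and> \<rho> powr (real N / 8) * real N \<le> d N"
    using log_vanishing_eventually_small[OF assms(5,7), of "real \<kappa>"]
      subexponential_dominates_geometric[OF assms(6) \<rho>] assms(1)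
    by (intro eventually_conj eventually_ge_at_top) auto
  have main: "\<forall>\<^sub>F N in sequentially.
      ennreal (1 / C) \<le> ennreal (d N ^ 3 / real N ^ 2) * (\<integral>\<^sup>+ w. hitting_time (\<eta> N) (condensate ?S N y) w \<partial>M N)
      \<and> ennreal (d N ^ 3 / real N ^ 2) * (\<integral>\<^sup>+ w. hitting_time (\<eta> N) (condensate ?S N y) w \<partial>M N) \<le> ennreal C'"
    if xy: "(x = 1 \<and> y = \<kappa>) \<or> (x = \<kappa> \<and> y = 1)"
      and process: "\<forall>N\<ge>1. inclusion_process_from ?S r (d N) N x (M N) (\<eta> N)"
    for x y and M :: "nat \<Rightarrow> 'w measure" and \<eta> :: "nat \<Rightarrow> real \<Rightarrow> 'w \<Rightarrow> nat \<Rightarrow> nat"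
    using large
  proof eventually_elim
    case (elim N)
    then obtain n where n: "N = Suc n" by (cases N) auto
    interpret inclusion_bottleneck ?S r \<alpha> "d N" 1 2 3 "{4..\<kappa>}" \<rho>
      using elim by (intro bottleneck) simp
    \<comment> \<open>The path through all sites, read in the direction of travel.\<close>
    define s where "s i = (if x = 1 then Suc i else \<kappa> - i)" for i
    have "\<exists>v. (\<integral>\<^sup>+ w. hitting_time (\<eta> N) (condensate ?S (Suc n) y) w \<partial>M N) = ennreal v
      \<and> 1 / ramp_energy_constant \<le> d N ^ 3 / (real (Suc n))\<^sup>2 * v
      \<and> d N ^ 3 / (real (Suc n))\<^sup>2 * v \<le> 3 * real (card ?S) * real (\<kappa> - 1) / K"
    proof (rule expected_crossing_time_bounds[where a = x and s = s])
      show "inclusion_process_from ?S r (d N) (Suc n) x (M N) (\<eta> N)" using process n elim by auto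
      show "x = 1 \<and> y \<in> {4..\<kappa>} \<or> x \<in> {4..\<kappa>} \<and> y = 1" using xy assms(1) by auto
      show "s 0 = x" "s (\<kappa> - 1) = y" using xy assms(1) by (auto simp: s_def)
      show "s i \<in> ?S" if "i \<le> \<kappa> - 1" for i using that assms(1) by (auto simp: s_def)
      show "inj_on s {..\<kappa> - 1}" using assms(1) by (auto simp: s_def inj_on_def)
      show "\<alpha> x = 1" "\<alpha> y = 1" using xy m1 mk top_pos by (auto simp: \<alpha>_def)
      show "K \<le> \<alpha> (s i) * r (s i) (s (Suc i)) / 2" if i: "i < \<kappa> - 1" for i
      proof (cases "x = 1")
        case True
        then show ?thesis using K_le[of "Suc i"] i by (simp add: s_def)
      next
        case False
        have suc: "\<kappa> - i = Suc (\<kappa> - Suc i)" using i by simp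
        have "\<alpha> (\<kappa> - i) * r (\<kappa> - i) (\<kappa> - Suc i) = \<alpha> (\<kappa> - Suc i) * r (\<kappa> - Suc i) (\<kappa> - i)"
          using i by (intro balance) auto
        moreover have "K \<le> \<alpha> (\<kappa> - Suc i) * r (\<kappa> - Suc i) (Suc (\<kappa> - Suc i)) / 2"
          using i by (intro K_le) auto
        ultimately show ?thesis using False suc by (simp add: s_def)
      qed
      show "8 \<le> real (Suc n)" "real (card ?S) * d N * (1 + ln (real (Suc n))) \<le> 1"
        "\<rho> powr (real (Suc n) / 8) * real (Suc n) \<le> d N"
        using elim n by (simp_all del: of_nat_Suc)
    qed (use K_pos bridge in auto)
    then obtain v where v: "(\<integral>\<^sup>+ w. hitting_time (\<eta> N) (condensate ?S N y) w \<partial>M N) = ennreal v"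
      "1 / C \<le> d N ^ 3 / real N ^ 2 * v" "d N ^ 3 / real N ^ 2 * v \<le> C'"
      unfolding ramp_energy_constant_def C_def C'_def n by auto
    have "0 \<le> d N ^ 3 / real N ^ 2" using d_pos by simp
    then have "ennreal (d N ^ 3 / real N ^ 2) * ennreal v = ennreal (d N ^ 3 / real N ^ 2 * v)"
      by (simp only: ennreal_mult')
    then show ?case unfolding v(1) using v(2,3) by (simp only: ennreal_leI simp_thms)
  qed
  show ?thesis
  proof (rule exI[of _ "1 / C"], rule exI[of _ C'], intro conjI ballI impI allI)
    fix x y and M :: "nat \<Rightarrow> 'w measure" and \<eta> :: "nat \<Rightarrow> real \<Rightarrow> 'w \<Rightarrow> nat \<Rightarrow> nat"
    assume "x \<in> max_sites ?S m" "y \<in> max_sites ?S m" "x \<noteq> y"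
      and process: "\<forall>N\<ge>1. inclusion_process_from ?S r (d N) N x (M N) (\<eta> N)"
    then have xy: "(x = 1 \<and> y = \<kappa>) \<or> (x = \<kappa> \<and> y = 1)" using assms(4) by auto
    let ?T = "\<lambda>N. ennreal (d N ^ 3 / real N ^ 2) * (\<integral>\<^sup>+ w. hitting_time (\<eta> N) (condensate ?S N y) w \<partial>M N)"
    have "ennreal (1 / C) \<le> liminf ?T"
      by (rule Liminf_bounded, rule eventually_mono[OF main[OF xy process]]) (erule conjunct1)
    moreover have "limsup ?T \<le> ennreal C'"
      by (rule Limsup_bounded, rule eventually_mono[OF main[OF xy process]]) (erule conjunct2)
    moreover have "liminf ?T \<le> limsup ?T" by (rule Liminf_le_Limsup) simp
    ultimately show "let T = ?T in ennreal (1 / C) \<le> liminf T \<and> liminf T \<le> limsup T \<and> limsup T \<le> ennreal C'"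
      by (simp only: Let_def simp_thms)
  qed (use C_pos C'_pos in auto)
qed

end
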